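(* Let $R/I_{\mathcal{A}}$ be a $3$-dimensional simplicial toric ring, with all notation as in the context. For all $\mathbf{x}^\alpha=u\,x_{n-2}^a x_{n-1}^b\in\mathcal{B}_2'$ (with $u\in\mathcal{B}_0\cap J$), $$\mathbf{x}^\alpha\in\mathcal{B}_2\iff u\,x_{n-2}^a x_{n-1}^{b-1}\in I_{\mathcal{A}}+\langle x_n\rangle.$$ Therefore, $$\mathcal{B}_2=\{u\,x_{n-2}^a x_{n-1}^b\in\mathcal{B}_2'\mid u\,x_{n-2}^a x_{n-1}^{b-1}\in I_{\mathcal{A}}+\langle x_n\rangle\}.$$
   Context: Let $\Bbbk$ be an arbitrary field, $\mathcal{A}=\{\mathbf{a}_1,\ldots,\mathbf{a}_n\}\subset\mathbb{N}^3$ a finite set of nonzero vectors and $\mathcal{S}$ the affine monoid it spans. Assume $\mathcal{S}$ is simplicial, i.e. the rational cone spanned by $\mathcal{A}$ has dimension $3$ and is generated by $3$ rays, and that these extremal rays are spanned by the last three generators $\mathbf{a}_{n-2},\mathbf{a}_{n-1},\mathbf{a}_n$. Let $R=\Bbbk[x_1,\ldots,x_n]$, $A=\Bbbk[x_{n-2},x_{n-1},x_n]$, and let $I=I_{\mathcal{A}}\subset R$ be the toric ideal (kernel of $x_i\mapsto\mathbf{t}^{\mathbf{a}_i}$). For a monomial, $|\mathbf{x}^\alpha|_{\mathcal{S}}=\sum_i\alpha_i\mathbf{a}_i\in\mathcal{S}$ is its $\mathcal{S}$-degree; $I$ is homogeneous for the $\mathcal{S}$-grading, and $R/I$ is a finitely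 generated $\mathcal{S}$-graded $A$-module ($A$ is a Noether normalization of $R/I$). Let $\omega=(\omega_1,\ldots,\omega_n)$ with $\omega_i=|\mathbf{a}_i|$ the sum of the entries of $\mathbf{a}_i$, and let $>_\omega$ be the $\omega$-graded reverse lexicographic order: $\mathbf{x}^\alpha>_\omega\mathbf{x}^\beta$ iff $\sum\omega_i\alpha_i>\sum\omega_i\beta_i$, or these are equal and the last nonzero entry of $\alpha-\beta$ is negative. $\mathrm{in}(\cdot)$ is taken with respect to $>_\omega$. $\mathcal{B}_0$ is the set of monomials of $R$ not in $\mathrm{in}(I)+\langle x_{n-2},x_{n-1},x_n\rangle$. $J\subset R$ is the ideal generated by $\chi(\mathrm{in}(I))$, where $\chi:R\to R$ is the $\Bbbk$-algebra morphism fixing $x_1,\ldots,x_{n-3}$ and sending $x_{n-2},x_{n-1},x_n$ to $1$. For $u\in\mathcal{B}_0\cap J$, $I_u=(\mathrm{in}(I):u)\cap A$ and $G(I_u)=\{M_{(u,1)},\ldots,M_{(u,\ell_u)}\}$ is its minimal monomial generating set (monomials in $x_{n-2},x_{n-1}$ only), sorted so that $M_{(u,1)}>\cdots>M_{(u,\ell_u)}$ for the lexicographic order with $x_n>x_{n-1}>x_{n-2}$. Set $$\mathcal{B}_2'=\{u\cdot\mathrm{lcm}(M_{(u,i)},M_{(u,i+1)})\mid u\in\mathcal{B}_0\cap J,\ \ell_u\ge2,\ 1\le i<\ell_u\}.$$ Every element of $\mathcal{B}_2'$ has the form $u\,x_{n-2}^a x_{n-1}^b$ with $u\in\mathcal{B}_0\cap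 J$ and $a,b\ge1$. The monomials of $\mathcal{B}_2'$ give the shifts in homological degree $2$ of a (not necessarily minimal) $\mathcal{S}$-graded free resolution of $R/I$ as $A$-module. $\mathcal{B}_2\subset\mathcal{B}_2'$ is the subset giving the actual shifts in the second step of the short resolution of $R/I$: i.e. $\mathcal{B}_2$ is such that the multiset $\{|\mathbf{x}^\alpha|_{\mathcal{S}}\mid\mathbf{x}^\alpha\in\mathcal{B}_2\}$ equals the multiset of shifts of the free module in homological degree $2$ of the minimal $\mathcal{S}$-graded free resolution of $R/I$ as an $A$-module. *)

theory Defs
  imports
    "HOL-Analysis.Cartesian_Space"
    "HOL-Library.Numeral_Type"
    "HOL-Library.Multiset"
    "HOL-Library.Poly_Mapping"
begin

section \<open>Polynomials and ideals\<close>

text \<open>A monomial is identified with its exponent vector, and the variable \<open>x\<^sub>i\<close> with the index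
  \<open>i\<close>.  The type of polynomials has countably many variables; the polynomial ring in a given set of
  variables is singled out by the carrier set \<open>polys\<close>.\<close>

type_synonym mono = "nat \<Rightarrow>\<^sub>0 nat"
type_synonym 'k mpoly = "mono \<Rightarrow>\<^sub>0 'k"

abbreviation keys :: "('a \<Rightarrow>\<^sub>0 'b::zero) \<Rightarrow> 'a set" where
  "keys \<equiv> Poly_Mapping.keys"

abbreviation lookup :: "('a \<Rightarrow>\<^sub>0 'b::zero) \<Rightarrow> 'a \<Rightarrow> 'b" where
  "lookup \<equiv> Poly_Mapping.lookup"

abbreviation mon :: "mono \<Rightarrow> 'k::field mpoly" where
  "mon m \<equiv> Poly_Mapping.single m 1"

abbreviation Var :: "nat \<Rightarrow> 'k::field mpoly" where
  "Var i \<equiv> mon (Poly_Mapping.single i 1)"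

definition polys :: "nat set \<Rightarrow> 'k::field mpoly set" where
  "polys V = {f. \<forall>m\<in>keys f. keys m \<subseteq> V}"

text \<open>The ideal of \<^term>\<open>polys V\<close> generated by a subset \<open>G\<close> of \<^term>\<open>polys V\<close>.\<close>

definition ideal_of :: "nat set \<Rightarrow> 'k::field mpoly set \<Rightarrow> 'k mpoly set" where
  "ideal_of V G = {\<Sum>g\<in>E. c g * g | E c. finite E \<and> E \<subseteq> G \<and> (\<forall>g\<in>E. c g \<in> polys V)}"

definition ideal_sum :: "'k::field mpoly set \<Rightarrow> 'k mpoly set \<Rightarrow> 'k mpoly set" where
  "ideal_sum I J = {f + g | f g. f \<in> I \<and> g \<in> J}"

text \<open>The algebra homomorphism from the polynomial ring in \<open>x\<^sub>1, \<dots>, x\<^sub>n\<close> to the monoid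
  algebra of \<open>'b\<close> sending \<open>x\<^sub>i\<close> to \<open>\<phi> i\<close>.\<close>

definition alg_hom ::
  "nat \<Rightarrow> (nat \<Rightarrow> ('b::comm_monoid_add \<Rightarrow>\<^sub>0 'k::field)) \<Rightarrow> 'k mpoly \<Rightarrow> ('b \<Rightarrow>\<^sub>0 'k)" where
  "alg_hom n \<phi> f =
     (\<Sum>m\<in>keys f. Poly_Mapping.single 0 (lookup f m) * (\<Prod>i\<in>{1..n}. \<phi> i ^ lookup m i))"

abbreviation last3 :: "nat \<Rightarrow> nat set" where
  "last3 n \<equiv> {n - 2, n - 1, n}"

section \<open>The simplicial affine monoid and its toric ideal\<close>

definition rat_vec :: "nat^3 \<Rightarrow> rat^3" where
  "rat_vec v = (\<chi> j. of_nat (v $ j))"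

definition rat_cone :: "(nat \<Rightarrow> nat^3) \<Rightarrow> nat set \<Rightarrow> (rat^3) set" where
  "rat_cone a K = {\<Sum>i\<in>K. q i *s rat_vec (a i) | q. \<forall>i\<in>K. q i \<ge> 0}"

text \<open>Three generators of a three-dimensional cone are linearly independent, so the last condition
  makes the last three vectors span the (exactly three) extremal rays.\<close>

definition simplicial :: "nat \<Rightarrow> (nat \<Rightarrow> nat^3) \<Rightarrow> bool" where
  "simplicial n a \<longleftrightarrow> n \<ge> 3 \<and> (\<forall>i\<in>{1..n}. a i \<noteq> 0) \<and>
     vec.dim (rat_cone a {1..n}) = 3 \<and> rat_cone a {1..n} = rat_cone a (last3 n)"

definition affine_monoid :: "nat \<Rightarrow> (nat \<Rightarrow> nat^3) \<Rightarrow> (nat^3) set" where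
  "affine_monoid n a = {\<Sum>i\<in>{1..n}. c i *s a i | c. True}"

definition sdeg :: "nat \<Rightarrow> (nat \<Rightarrow> nat^3) \<Rightarrow> mono \<Rightarrow> nat^3" where
  "sdeg n a m = (\<Sum>i\<in>{1..n}. lookup m i *s a i)"

text \<open>The ring \<open>k[t\<^sub>1, t\<^sub>2, t\<^sub>3]\<close> is taken as the monoid algebra of \<^typ>\<open>nat^3\<close>.\<close>

definition toric_ideal :: "nat \<Rightarrow> (nat \<Rightarrow> nat^3) \<Rightarrow> 'k::field mpoly set" where
  "toric_ideal n a =
     {f \<in> polys {1..n}. alg_hom n (\<lambda>i. Poly_Mapping.single (a i) (1::'k)) f = 0}"

section \<open>The initial ideal and the sets of monomials\<close>

definition omega :: "(nat \<Rightarrow> nat^3) \<Rightarrow> nat \<Rightarrow> nat" where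
  "omega a i = (\<Sum>j\<in>UNIV. a i $ j)"

definition omega_deg :: "nat \<Rightarrow> (nat \<Rightarrow> nat^3) \<Rightarrow> mono \<Rightarrow> nat" where
  "omega_deg n a m = (\<Sum>i\<in>{1..n}. omega a i * lookup m i)"

definition revlex_gt :: "nat \<Rightarrow> (nat \<Rightarrow> nat^3) \<Rightarrow> mono \<Rightarrow> mono \<Rightarrow> bool" where
  "revlex_gt n a m m' \<longleftrightarrow> omega_deg n a m > omega_deg n a m' \<or>
     omega_deg n a m = omega_deg n a m' \<and>
       (\<exists>i\<in>{1..n}. lookup m i < lookup m' i \<and> (\<forall>j\<in>{i<..n}. lookup m j = lookup m' j))"

definition is_lead_mon :: "nat \<Rightarrow> (nat \<Rightarrow> nat^3) \<Rightarrow> 'k::field mpoly \<Rightarrow> mono \<Rightarrow> bool" where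
  "is_lead_mon n a f m \<longleftrightarrow> m \<in> keys f \<and> (\<forall>m'\<in>keys f - {m}. revlex_gt n a m m')"

definition init_ideal :: "nat \<Rightarrow> (nat \<Rightarrow> nat^3) \<Rightarrow> 'k::field mpoly set \<Rightarrow> 'k mpoly set" where
  "init_ideal n a I = ideal_of {1..n} {mon m | m. \<exists>f\<in>I. is_lead_mon n a f m}"

text \<open>In the following definitions \<open>L\<close> is the initial ideal.\<close>

definition B0 :: "nat \<Rightarrow> 'k::field mpoly set \<Rightarrow> mono set" where
  "B0 n L = {m. keys m \<subseteq> {1..n} \<and>
                mon m \<notin> ideal_sum L (ideal_of {1..n} (Var ` last3 n))}"

definition chi :: "nat \<Rightarrow> 'k::field mpoly \<Rightarrow> 'k mpoly" where
  "chi n = alg_hom n (\<lambda>i. if i \<in> last3 n then 1 else Var i)"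

definition J_ideal :: "nat \<Rightarrow> 'k::field mpoly set \<Rightarrow> 'k mpoly set" where
  "J_ideal n L = ideal_of {1..n} (chi n ` L)"

definition B0J :: "nat \<Rightarrow> 'k::field mpoly set \<Rightarrow> mono set" where
  "B0J n L = {u \<in> B0 n L. mon u \<in> J_ideal n L}"

definition I_u :: "nat \<Rightarrow> 'k::field mpoly set \<Rightarrow> mono \<Rightarrow> 'k mpoly set" where
  "I_u n L u = {f \<in> polys (last3 n). mon u * f \<in> L}"

definition lex_gt :: "nat \<Rightarrow> mono \<Rightarrow> mono \<Rightarrow> bool" where
  "lex_gt n m m' \<longleftrightarrow> lookup m n > lookup m' n \<or>
     lookup m n = lookup m' n \<and> (lookup m (n - 1) > lookup m' (n - 1) \<or>
       lookup m (n - 1) = lookup m' (n - 1) \<and> lookup m (n - 2) > lookup m' (n - 2))"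

text \<open>\<open>Ms\<close> is the list, decreasing for the lexicographic order, of the minimal monomial generators
  of the ideal \<open>K\<close> of the polynomial ring in the last three variables.\<close>

definition sorted_min_gens :: "nat \<Rightarrow> 'k::field mpoly set \<Rightarrow> mono list \<Rightarrow> bool" where
  "sorted_min_gens n K Ms \<longleftrightarrow>
     (\<forall>M\<in>set Ms. keys M \<subseteq> last3 n) \<and>
     ideal_of (last3 n) (mon ` set Ms) = K \<and>
     (\<forall>T. T \<subset> set Ms \<longrightarrow> ideal_of (last3 n) (mon ` T) \<noteq> K) \<and>
     sorted_wrt (lex_gt n) Ms"

definition mono_lcm :: "mono \<Rightarrow> mono \<Rightarrow> mono" where
  "mono_lcm m m' = Abs_poly_mapping (\<lambda>i. max (lookup m i) (lookup m' i))"

lemma lookup_mono_lcm: "lookup (mono_lcm m m') i = max (lookup m i) (lookup m' i)"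
proof -
  have "{i. max (lookup m i) (lookup m' i) \<noteq> 0} \<subseteq> keys m \<union> keys m'"
    by (auto simp: in_keys_iff max_def split: if_splits)
  then have "finite {i. max (lookup m i) (lookup m' i) \<noteq> 0}"
    by (rule finite_subset) simp
  then show ?thesis
    unfolding mono_lcm_def by (simp add: Abs_poly_mapping_inverse)
qed

text \<open>The index \<open>i\<close> starts at \<open>0\<close> here; \<open>Suc i < length Ms\<close> includes \<open>length Ms \<ge> 2\<close>.\<close>

definition B2' :: "nat \<Rightarrow> 'k::field mpoly set \<Rightarrow> mono set" where
  "B2' n L = {u + mono_lcm (Ms ! i) (Ms ! Suc i) | u Ms i.
                u \<in> B0J n L \<and> sorted_min_gens n (I_u n L u) Ms \<and> Suc i < length Ms}"

section \<open>Minimal graded free resolutions of \<open>R/I\<close> over \<open>A\<close>\<close>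

text \<open>The data of a complex of finitely generated graded free modules augmented to \<open>R/I\<close>:
  \<open>F\<^sub>j\<close> is free of rank \<open>rk j\<close> (possibly \<open>0\<close>), its basis element number \<open>q < rk j\<close> has degree
  \<open>shift j q\<close>; \<open>dmat j\<close> is the matrix of \<open>F\<^sub>j\<^sub>+\<^sub>1 \<rightarrow> F\<^sub>j\<close>; the basis element \<open>q\<close> of \<open>F\<^sub>0\<close> is sent to
  the class of \<open>aug q\<close> in \<open>R/I\<close>.\<close>

record (overloaded) ('k::zero) graded_complex =
  rk :: "nat \<Rightarrow> nat"
  shift :: "nat \<Rightarrow> nat \<Rightarrow> nat^3"
  aug :: "nat \<Rightarrow> 'k mpoly"
  dmat :: "nat \<Rightarrow> nat \<Rightarrow> nat \<Rightarrow> 'k mpoly"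

definition free_mod :: "nat set \<Rightarrow> nat \<Rightarrow> (nat \<Rightarrow> 'k::field mpoly) set" where
  "free_mod V r = {v. (\<forall>q<r. v q \<in> polys V) \<and> (\<forall>q\<ge>r. v q = 0)}"

definition aug_map :: "'k::field graded_complex \<Rightarrow> (nat \<Rightarrow> 'k mpoly) \<Rightarrow> 'k mpoly" where
  "aug_map F v = (\<Sum>q<rk F 0. v q * aug F q)"

definition dmap :: "'k::field graded_complex \<Rightarrow> nat \<Rightarrow> (nat \<Rightarrow> 'k mpoly) \<Rightarrow> (nat \<Rightarrow> 'k mpoly)" where
  "dmap F j v = (\<lambda>p. if p < rk F j then \<Sum>q<rk F (Suc j). dmat F j p q * v q else 0)"

text \<open>Differentials and augmentation are homogeneous of degree \<open>0\<close>.\<close>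

definition is_graded_complex ::
  "nat \<Rightarrow> (nat \<Rightarrow> nat^3) \<Rightarrow> 'k::field graded_complex \<Rightarrow> bool" where
  "is_graded_complex n a F \<longleftrightarrow>
     (\<forall>j. \<forall>q<rk F j. shift F j q \<in> affine_monoid n a) \<and>
     (\<forall>q<rk F 0. aug F q \<in> polys {1..n} \<and> (\<forall>m\<in>keys (aug F q). sdeg n a m = shift F 0 q)) \<and>
     (\<forall>j. \<forall>p<rk F j. \<forall>q<rk F (Suc j). dmat F j p q \<in> polys (last3 n) \<and>
        (\<forall>m\<in>keys (dmat F j p q). sdeg n a m + shift F j p = shift F (Suc j) q))"

definition exact_augmented ::
  "nat \<Rightarrow> 'k::field mpoly set \<Rightarrow> 'k graded_complex \<Rightarrow> bool" where
  "exact_augmented n I F \<longleftrightarrow>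
     (\<forall>f\<in>polys {1..n}. \<exists>v\<in>free_mod (last3 n) (rk F 0). f - aug_map F v \<in> I) \<and>
     {v \<in> free_mod (last3 n) (rk F 0). aug_map F v \<in> I}
       = dmap F 0 ` free_mod (last3 n) (rk F 1) \<and>
     (\<forall>j. {v \<in> free_mod (last3 n) (rk F (Suc j)). dmap F j v = (\<lambda>_. 0)}
            = dmap F (Suc j) ` free_mod (last3 n) (rk F (Suc (Suc j))))"

text \<open>Minimality: the image of \<open>F\<^sub>j\<^sub>+\<^sub>1\<close> lies in \<open>\<mm> F\<^sub>j\<close>, where \<open>\<mm>\<close> is the ideal
  of \<open>A\<close> generated by its variables.\<close>

definition min_graded_free_res ::
  "nat \<Rightarrow> (nat \<Rightarrow> nat^3) \<Rightarrow> 'k::field mpoly set \<Rightarrow> 'k graded_complex \<Rightarrow> bool" where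
  "min_graded_free_res n a I F \<longleftrightarrow> is_graded_complex n a F \<and> exact_augmented n I F \<and>
     (\<forall>j. \<forall>p<rk F j. \<forall>q<rk F (Suc j). dmat F j p q \<in> ideal_of (last3 n) (Var ` last3 n))"

definition shifts :: "'k::field graded_complex \<Rightarrow> nat \<Rightarrow> (nat^3) multiset" where
  "shifts F j = image_mset (shift F j) (mset_set {..<rk F j})"

text \<open>Finiteness is required explicitly because \<^const>\<open>mset_set\<close> is empty on infinite sets.\<close>

definition is_B2 ::
  "nat \<Rightarrow> (nat \<Rightarrow> nat^3) \<Rightarrow> 'k::field mpoly set \<Rightarrow> 'k graded_complex \<Rightarrow> mono set \<Rightarrow> bool" where
  "is_B2 n a I F B \<longleftrightarrow> B \<subseteq> B2' n (init_ideal n a I) \<and> finite B \<and>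
     image_mset (sdeg n a) (mset_set B) = shifts F 2"

end

theory Submission
  imports Defs "HOL-Library.Function_Algebras"
begin

text \<open>
  Write \<open>e\<^sub>1, e\<^sub>2, e\<^sub>3\<close> for the last three generators and \<open>S\<close> for the affine monoid.  By comparison with
  the Koszul complex of \<open>k[S]\<close> over \<open>A\<close>, a degree \<open>s\<close> is a shift of the second module of the minimal
  resolution iff \<open>s - e\<^sub>1 - e\<^sub>2\<close>, \<open>s - e\<^sub>1 - e\<^sub>3\<close>, \<open>s - e\<^sub>2 - e\<^sub>3\<close> lie in \<open>S\<close> but
  \<open>s - e\<^sub>1 - e\<^sub>2 - e\<^sub>3\<close> does not.

  An element \<open>u x\<^sup>\<alpha> y\<^sup>\<beta>\<close> of \<open>B2'\<close> is a corner of a staircase: \<open>u x\<^sup>\<alpha>\<^sup>-\<^sup>1 y\<^sup>\<beta>\<^sup>-\<^sup>1\<close> is a standard monomial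
  while \<open>u x\<^sup>\<alpha>\<^sup>-\<^sup>1 y\<^sup>\<beta>\<close> is not.  As the order is reverse lexicographic, the first fact shows
  \<open>s - e\<^sub>1 - e\<^sub>2 - e\<^sub>3 \<notin> S\<close> and that \<open>s\<close> determines the corner; by the second one, the
  standard monomial of degree \<open>s - e\<^sub>1\<close> is divisible by the last variable, so \<open>s - e\<^sub>1 - e\<^sub>3 \<in> S\<close>.  The
  only condition left is \<open>s - e\<^sub>2 - e\<^sub>3 \<in> S\<close>, which says that \<open>u x\<^sup>\<alpha> y\<^sup>\<beta>\<^sup>-\<^sup>1\<close> is congruent modulo \<open>I\<close> to a
  multiple of the last variable.
\<close>

section \<open>Polynomials\<close>

definition part :: "('a \<Rightarrow> bool) \<Rightarrow> ('a \<Rightarrow>\<^sub>0 'b::zero) \<Rightarrow> ('a \<Rightarrow>\<^sub>0 'b)" where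
  "part P f = Abs_poly_mapping (\<lambda>m. lookup f m when P m)"

lemma lookup_part: "lookup (part P f) m = (lookup f m when P m)"
proof -
  have "{m. (lookup f m when P m) \<noteq> 0} \<subseteq> keys f"
    by (auto simp: in_keys_iff)
  then have "finite {m. (lookup f m when P m) \<noteq> 0}"
    by (rule finite_subset) simp
  then show ?thesis
    unfolding part_def by simp
qed

lemma keys_part: "keys (part P f) = {m \<in> keys f. P m}"
  by (auto simp: in_keys_iff lookup_part)

lemma part_zero [simp]: "part P 0 = 0"
  by (rule poly_mapping_eqI) (simp add: lookup_part)

lemma part_add: "part P (f + g) = part P f + part P g"
  by (rule poly_mapping_eqI) (simp add: lookup_part lookup_add when_add_distrib)

lemma part_diff:
  fixes f g :: "'a \<Rightarrow>\<^sub>0 'b::ab_group_add"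
  shows "part P (f - g) = part P f - part P g"
  by (rule poly_mapping_eqI) (simp add: lookup_part lookup_minus when_diff_distrib)

lemma part_sum: "part P (sum f A) = (\<Sum>i\<in>A. part P (f i))"
  by (induction A rule: infinite_finite_induct) (simp_all add: part_add)

lemma part_id: "(\<And>m. m \<in> keys f \<Longrightarrow> P m) \<Longrightarrow> part P f = f"
  by (rule poly_mapping_eqI) (auto simp: lookup_part in_keys_iff when_def)

lemma part_eq_0: "(\<And>m. m \<in> keys f \<Longrightarrow> \<not> P m) \<Longrightarrow> part P f = 0"
  by (rule poly_mapping_eqI) (auto simp: lookup_part in_keys_iff when_def)

lemma part_decomp: "f = part P f + part (\<lambda>m. \<not> P m) f"
  by (rule poly_mapping_eqI) (auto simp: lookup_part lookup_add when_def)

text \<open>Multiplying by \<open>D\<close> sends terms satisfying \<open>Q\<close> to terms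
  satisfying \<open>P\<close> and the others to terms violating \<open>P\<close>, so splitting
  \<open>f\<close> by \<open>Q\<close> splits the product by \<open>P\<close>. The compatibility of
  homogeneous maps with degrees rests on this.\<close>

lemma part_mult:
  fixes D f :: "'a::monoid_add \<Rightarrow>\<^sub>0 'b::semiring_0"
  assumes "\<And>m m'. m \<in> keys D \<Longrightarrow> P (m + m') \<longleftrightarrow> Q m'"
  shows "part P (D * f) = D * part Q f"
proof -
  have "part P (D * part Q f) = D * part Q f"
    by (rule part_id) (use keys_mult[of D "part Q f"] assms in \<open>auto simp: keys_part\<close>)
  moreover have "part P (D * part (\<lambda>m. \<not> Q m) f) = 0"
    by (rule part_eq_0)
      (use keys_mult[of D "part (\<lambda>m. \<not> Q m) f"] assms in \<open>auto simp: keys_part\<close>)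
  ultimately show ?thesis
    by (subst part_decomp[of f Q]) (simp add: distrib_left part_add)
qed

lemma poly_mapping_eq_sum_single:
  fixes f :: "'a \<Rightarrow>\<^sub>0 'b::comm_monoid_add"
  shows "f = (\<Sum>m\<in>keys f. Poly_Mapping.single m (lookup f m))"
proof (rule poly_mapping_eqI)
  fix k
  have "(\<Sum>m\<in>keys f. lookup f m when m = k) = (\<Sum>m\<in>keys f. if m = k then lookup f m else 0)"
    by (simp add: when_def)
  also have "\<dots> = lookup f k"
    by (auto simp: in_keys_iff)
  finally show "lookup f k = lookup (\<Sum>m\<in>keys f. Poly_Mapping.single m (lookup f m)) k"
    by (simp add: lookup_sum lookup_single)
qed

text \<open>This is evaluation with all variables equal to 1, hence multiplicative. On polynomials
  of a single degree it detects the toric ideal, since all monomials of one degree have the same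
  image.\<close>

definition csum :: "('a \<Rightarrow>\<^sub>0 'b::comm_monoid_add) \<Rightarrow> 'b" where
  "csum f = (\<Sum>m\<in>keys f. lookup f m)"

lemma csum_superset: "finite B \<Longrightarrow> keys f \<subseteq> B \<Longrightarrow> csum f = (\<Sum>m\<in>B. lookup f m)"
  unfolding csum_def by (rule sum.mono_neutral_left) (auto simp: in_keys_iff)

lemma csum_zero [simp]: "csum 0 = 0"
  by (simp add: csum_def)

lemma csum_single [simp]: "csum (Poly_Mapping.single m c) = c"
  by (subst csum_superset[of "{m}"]) auto

lemma csum_add: "csum (f + g) = csum f + csum g"
proof -
  have "csum h = (\<Sum>m\<in>keys f \<union> keys g. lookup h m)" if "h \<in> {f, g, f + g}" for h
    by (rule csum_superset) (use that keys_add[of f g] in auto)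
  then show ?thesis
    by (simp add: lookup_add sum.distrib)
qed

lemma csum_diff:
  fixes f g :: "'a \<Rightarrow>\<^sub>0 'b::ab_group_add"
  shows "csum (f - g) = csum f - csum g"
  using csum_add[of "f - g" g] by simp

lemma csum_sum: "csum (sum f A) = (\<Sum>i\<in>A. csum (f i))"
  by (induction A rule: infinite_finite_induct) (simp_all add: csum_add)

lemma csum_mult:
  fixes f g :: "'a::monoid_add \<Rightarrow>\<^sub>0 'b::semiring_0"
  shows "csum (f * g) = csum f * csum g"
proof -
  have "csum (f * g) = csum ((\<Sum>m\<in>keys f. Poly_Mapping.single m (lookup f m)) *
      (\<Sum>m\<in>keys g. Poly_Mapping.single m (lookup g m)))"
    by (simp flip: poly_mapping_eq_sum_single)
  also have "\<dots> = (\<Sum>m\<in>keys f. \<Sum>m'\<in>keys g. lookup f m * lookup g m')"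
    by (simp add: sum_product csum_sum mult_single)
  also have "\<dots> = csum f * csum g"
    by (simp add: csum_def sum_product)
  finally show ?thesis .
qed

section \<open>Closure properties of the polynomial rings\<close>

lemma keys_mono_add: "keys ((m::mono) + m') = keys m \<union> keys m'"
  by (auto simp: in_keys_iff lookup_add)

lemma polys_keysD: "f \<in> polys V \<Longrightarrow> m \<in> keys f \<Longrightarrow> keys m \<subseteq> V"
  by (simp add: polys_def)

lemma polys_zero [simp]: "0 \<in> polys V"
  by (simp add: polys_def)

lemma polys_one [simp]: "1 \<in> polys V"
  by (simp add: polys_def)

lemma polys_single: "keys m \<subseteq> V \<Longrightarrow> Poly_Mapping.single m c \<in> polys V"
  by (simp add: polys_def)

lemma polys_Var: "i \<in> V \<Longrightarrow> Var i \<in> polys V"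
  by (simp add: polys_def)

lemma polys_add: "f \<in> polys V \<Longrightarrow> g \<in> polys V \<Longrightarrow> f + g \<in> polys V"
  using keys_add[of f g] by (auto simp: polys_def)

lemma polys_diff: "f \<in> polys V \<Longrightarrow> g \<in> polys V \<Longrightarrow> f - g \<in> polys V"
  using keys_diff[of f g] by (auto simp: polys_def)

lemma polys_uminus: "f \<in> polys V \<Longrightarrow> - f \<in> polys V"
  using polys_diff[of 0 V f] by simp

lemma polys_mult:
  assumes "f \<in> polys V" "g \<in> polys V"
  shows "f * g \<in> polys V"
  unfolding polys_def
proof (intro CollectI ballI)
  fix m assume "m \<in> keys (f * g)"
  then obtain b c where "m = b + c" "b \<in> keys f" "c \<in> keys g"
    using keys_mult[of f g] by blast
  then show "keys m \<subseteq> V"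
    using assms by (simp add: keys_mono_add polys_keysD)
qed

lemma polys_sum: "(\<And>i. i \<in> A \<Longrightarrow> f i \<in> polys V) \<Longrightarrow> sum f A \<in> polys V"
  by (induction A rule: infinite_finite_induct) (simp_all add: polys_add)

lemma polys_part: "f \<in> polys V \<Longrightarrow> part P f \<in> polys V"
  by (auto simp: polys_def keys_part)

lemma polys_mono: "V \<subseteq> W \<Longrightarrow> f \<in> polys V \<Longrightarrow> f \<in> polys W"
  unfolding polys_def by blast

section \<open>Division by a variable, with remainder\<close>

text \<open>Terms not divisible by the variable are dropped.\<close>

definition vquot :: "nat \<Rightarrow> 'k::field mpoly \<Rightarrow> 'k mpoly" where
  "vquot i = Poly_Mapping.map_key (\<lambda>m. Poly_Mapping.single i 1 + m)"

lemma lookup_vquot: "lookup (vquot i f) m = lookup f (Poly_Mapping.single i 1 + m)"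
  unfolding vquot_def by (simp add: map_key.rep_eq inj_def)

lemma lookup_mon_times_add:
  fixes f :: "'k::field mpoly"
  shows "lookup (mon r * f) (r + m) = lookup f m"
proof -
  \<comment> \<open>By cancellation of exponents, \<open>r + m\<close> can only come from the term
    \<open>m\<close> of \<open>f\<close>, so \<open>f\<close> may be cut down to that term.\<close>
  have "lookup (mon r * part (\<lambda>m'. m' = m) f) (r + m) = lookup (part (\<lambda>m'. m' = r + m) (mon r * f)) (r + m)"
    by (subst part_mult[where Q = "\<lambda>m'. m' = m"]) auto
  then have "lookup (mon r * f) (r + m) = lookup (mon r * part (\<lambda>m'. m' = m) f) (r + m)"
    by (simp add: lookup_part)
  also have "part (\<lambda>m'. m' = m) f = Poly_Mapping.single m (lookup f m)"
    by (rule poly_mapping_eqI) (auto simp: lookup_part lookup_single when_def)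
  finally show ?thesis
    by (simp add: mult_single)
qed

lemma lookup_mon_times_eq_0:
  fixes f :: "'k::field mpoly"
  assumes "\<And>m'. m \<noteq> r + m'"
  shows "lookup (mon r * f) m = 0"
proof (rule ccontr)
  assume "lookup (mon r * f) m \<noteq> 0"
  then show False
    using keys_mult[of "mon r" f] assms by (auto simp: in_keys_iff[symmetric])
qed

lemma single_dvd_iff: "(\<exists>r. (m::mono) = Poly_Mapping.single i 1 + r) \<longleftrightarrow> i \<in> keys m"
proof
  assume "i \<in> keys m"
  then have "m = Poly_Mapping.single i 1 + (m - Poly_Mapping.single i 1)"
    by (intro poly_mapping_eqI)
      (auto simp: lookup_add lookup_minus lookup_single when_def in_keys_iff)
  then show "\<exists>r. m = Poly_Mapping.single i 1 + r" ..
qed (auto simp: in_keys_iff lookup_add)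

lemma vquot_zero [simp]: "vquot i 0 = 0"
  by (rule poly_mapping_eqI) (simp add: lookup_vquot)

lemma vquot_add: "vquot i (f + g) = vquot i f + vquot i g"
  by (rule poly_mapping_eqI) (simp add: lookup_vquot lookup_add)

lemma vquot_Var_same: "vquot i (Var i * f) = f"
  by (rule poly_mapping_eqI) (simp only: lookup_vquot lookup_mon_times_add)

lemma vquot_Var_other:
  assumes "i \<noteq> j"
  shows "vquot i (Var j * f) = Var j * vquot i f"
proof (rule poly_mapping_eqI)
  fix m
  show "lookup (vquot i (Var j * f)) m = lookup (Var j * vquot i f) m"
  proof (cases "j \<in> keys m")
    case True
    then obtain r where "m = Poly_Mapping.single j 1 + r"
      using single_dvd_iff by blast
    then show ?thesis
      unfolding lookup_vquot
      by (simp only: add.left_commute[of "Poly_Mapping.single i 1"] lookup_mon_times_add lookup_vquot)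
  next
    case False
    then have "\<And>r. m \<noteq> Poly_Mapping.single j 1 + r"
      using single_dvd_iff by blast
    moreover have "j \<notin> keys (Poly_Mapping.single i 1 + m)"
      using False assms by (simp add: keys_mono_add)
    then have "\<And>r. Poly_Mapping.single i 1 + m \<noteq> Poly_Mapping.single j 1 + r"
      using single_dvd_iff by blast
    ultimately show ?thesis
      unfolding lookup_vquot by (metis lookup_mon_times_eq_0)
  qed
qed

lemma polys_vquot:
  assumes "f \<in> polys V"
  shows "vquot i f \<in> polys V"
  unfolding polys_def
proof (intro CollectI ballI)
  fix m assume "m \<in> keys (vquot i f)"
  then have "Poly_Mapping.single i 1 + m \<in> keys f"
    by (simp add: in_keys_iff lookup_vquot)
  then show "keys m \<subseteq> V"
    using polys_keysD[OF assms] keys_mono_add by blast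
qed

text \<open>Subtracting such quotients for one variable after another strips a polynomial down to
  its constant term.\<close>

lemma lookup_vrem: "lookup (f - Var i * vquot i f) m = (if i \<in> keys m then 0 else lookup f m)"
proof (cases "i \<in> keys m")
  case True
  then obtain r where "m = Poly_Mapping.single i 1 + r"
    using single_dvd_iff by blast
  then show ?thesis
    using True by (simp only: lookup_minus lookup_mon_times_add lookup_vquot) simp
next
  case False
  then have "\<And>r. m \<noteq> Poly_Mapping.single i 1 + r"
    using single_dvd_iff by blast
  then have "lookup (Var i * vquot i f) m = 0"
    by (rule lookup_mon_times_eq_0)
  then show ?thesis
    using False by (simp only: lookup_minus) simp
qed

section \<open>Monomial ideals\<close>

text \<open>Each term of a combination of monomials is a multiple of one of them; conversely, each
  term of \<open>f\<close> can be assigned a generator of its own.\<close>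

lemma ideal_of_mon_iff:
  fixes f :: "'k::field mpoly"
  assumes G: "\<And>g. g \<in> G \<Longrightarrow> keys g \<subseteq> V"
  shows "f \<in> ideal_of V (mon ` G) \<longleftrightarrow> f \<in> polys V \<and> (\<forall>m\<in>keys f. \<exists>g\<in>G. \<exists>r. m = g + r)"
proof
  assume "f \<in> ideal_of V (mon ` G)"
  then obtain E c where E: "finite E" "E \<subseteq> mon ` G" "\<And>g. g \<in> E \<Longrightarrow> c g \<in> polys V"
    and f: "f = (\<Sum>g\<in>E. c g * g)"
    unfolding ideal_of_def by blast
  have "f \<in> polys V"
    unfolding f by (rule polys_sum) (use E G in \<open>auto intro!: polys_mult polys_single\<close>)
  moreover have "\<exists>g\<in>G. \<exists>r. m = g + r" if m: "m \<in> keys f" for m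
  proof -
    obtain h where "h \<in> E" "m \<in> keys (c h * h)"
      using m keys_sum[of "\<lambda>g. c g * g" E] unfolding f by blast
    then obtain g where "g \<in> G" "h = mon g"
      using E by blast
    with \<open>m \<in> keys (c h * h)\<close> keys_mult[of "c h" h] obtain r where "m = r + g"
      by auto
    with \<open>g \<in> G\<close> show ?thesis
      by (metis add.commute)
  qed
  ultimately show "f \<in> polys V \<and> (\<forall>m\<in>keys f. \<exists>g\<in>G. \<exists>r. m = g + r)"
    by blast
next
  assume *: "f \<in> polys V \<and> (\<forall>m\<in>keys f. \<exists>g\<in>G. \<exists>r. m = g + r)"
  then obtain h r where h: "\<And>m. m \<in> keys f \<Longrightarrow> h m \<in> G \<and> m = h m + r m"
    by metis
  \<comment> \<open>\<open>ideal_of\<close> allows one coefficient per generator, so the cofactors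
    of all terms assigned to the same generator are collected.\<close>
  define c where "c p = (\<Sum>m\<in>{m. m \<in> keys f \<and> mon (h m) = p}. Poly_Mapping.single (r m) (lookup f m))"
    for p :: "'k mpoly"
  have "f = (\<Sum>m\<in>keys f. Poly_Mapping.single m (lookup f m))"
    by (rule poly_mapping_eq_sum_single)
  also have "\<dots> = (\<Sum>m\<in>keys f. Poly_Mapping.single (r m) (lookup f m) * mon (h m))"
    by (rule sum.cong) (auto simp: mult_single add.commute dest: h)
  also have "\<dots> = (\<Sum>p::'k mpoly\<in>(\<lambda>m. mon (h m)) ` keys f. \<Sum>m\<in>{m. m \<in> keys f \<and> mon (h m) = p}.
      Poly_Mapping.single (r m) (lookup f m) * mon (h m))"
    by (rule sum.image_gen) simp
  also have "\<dots> = (\<Sum>p\<in>(\<lambda>m. mon (h m)) ` keys f. c p * p)"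
    unfolding c_def sum_distrib_right by (intro sum.cong) auto
  finally have "f = (\<Sum>p\<in>(\<lambda>m. mon (h m)) ` keys f. c p * p)" .
  moreover have "c p \<in> polys V" for p
  proof -
    have "keys (r m) \<subseteq> V" if "m \<in> keys f" for m
      using h[OF that] polys_keysD[of f V m] * that keys_mono_add[of "h m" "r m"] by auto
    then show ?thesis
      unfolding c_def by (intro polys_sum polys_single) auto
  qed
  ultimately show "f \<in> ideal_of V (mon ` G)"
    unfolding ideal_of_def
    by (intro CollectI exI[of _ "(\<lambda>m. mon (h m)) ` keys f"] exI[of _ c]) (use h in auto)
qed

lemma ideal_of_Vars_iff:
  fixes f :: "'k::field mpoly"
  assumes "W \<subseteq> V"
  shows "f \<in> ideal_of V (Var ` W) \<longleftrightarrow> f \<in> polys V \<and> (\<forall>m\<in>keys f. keys m \<inter> W \<noteq> {})"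
proof -
  have Vars: "Var ` W = mon ` ((\<lambda>i. Poly_Mapping.single i 1) ` W)"
    by (simp add: image_image)
  have "f \<in> ideal_of V (mon ` ((\<lambda>i. Poly_Mapping.single i 1) ` W)) \<longleftrightarrow>
      f \<in> polys V \<and> (\<forall>m\<in>keys f. \<exists>g\<in>(\<lambda>i. Poly_Mapping.single i 1) ` W. \<exists>r. m = g + r)"
    by (rule ideal_of_mon_iff) (use assms in auto)
  then show ?thesis
    unfolding Vars[symmetric] bex_simps single_dvd_iff by blast
qed

section \<open>The toric ideal and its initial ideal\<close>

lemma sdeg_component: "sdeg n a m $ j = (\<Sum>i\<in>{1..n}. lookup m i * a i $ j)"
  by (simp add: sdeg_def)

lemma sdeg_zero [simp]: "sdeg n a 0 = 0"
  by (simp add: vec_eq_iff sdeg_component)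

lemma sdeg_add: "sdeg n a (m + m') = sdeg n a m + sdeg n a m'"
  by (simp add: vec_eq_iff sdeg_component lookup_add distrib_right sum.distrib)

lemma sdeg_Var:
  assumes "i \<in> {1..n}"
  shows "sdeg n a (Poly_Mapping.single i 1) = a i"
proof -
  have "(\<Sum>k\<in>{1..n}. (1 when i = k) * a k $ j) = (\<Sum>k\<in>{1..n}. if k = i then a k $ j else 0)" for j
    by (rule sum.cong) (auto simp: when_def)
  then show ?thesis
    using assms by (simp add: vec_eq_iff sdeg_component lookup_single)
qed

lemma affine_monoid_iff:
  "t \<in> affine_monoid n a \<longleftrightarrow> (\<exists>m. keys m \<subseteq> {1..n} \<and> sdeg n a m = t)"
proof
  assume "t \<in> affine_monoid n a"
  then obtain c where t: "t = (\<Sum>i\<in>{1..n}. c i *s a i)"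
    unfolding affine_monoid_def by blast
  \<comment> \<open>Values of \<open>c\<close> outside the index range are cut off to get finite
    support.\<close>
  have "finite {i. (c i when i \<in> {1..n}) \<noteq> 0}"
    by (rule finite_subset[of _ "{1..n}"]) (auto simp: when_def)
  then obtain m where l: "\<And>i. lookup m i = (c i when i \<in> {1..n})"
    using lookup_Abs_poly_mapping by metis
  then have "keys m \<subseteq> {1..n}" "sdeg n a m = t"
    by (auto simp: in_keys_iff sdeg_def t when_def intro!: sum.cong split: if_splits)
  then show "\<exists>m. keys m \<subseteq> {1..n} \<and> sdeg n a m = t"
    by blast
qed (auto simp: affine_monoid_def sdeg_def)

lemma single_power: "Poly_Mapping.single (x::nat^3) (1::'k::field) ^ k = Poly_Mapping.single (k *s x) 1"
proof (induction k)
  case 0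
  have "(0::nat) *s x = 0"
    by (simp add: vec_eq_iff)
  then show ?case
    by simp
next
  case (Suc k)
  have "x + k *s x = Suc k *s x"
    by (simp add: vec_eq_iff)
  with Suc show ?case
    by (simp add: mult_single)
qed

lemma prod_single:
  "finite A \<Longrightarrow> (\<Prod>i\<in>A. Poly_Mapping.single (f i) (1::'k::field)) = Poly_Mapping.single (\<Sum>i\<in>A. f i) 1"
  by (induction A rule: finite_induct) (simp_all add: mult_single)

text \<open>All monomials of degree \<open>d\<close> have the same image, so their coefficients
  simply add up.\<close>

lemma lookup_alg_hom:
  fixes f :: "'k::field mpoly"
  shows "lookup (alg_hom n (\<lambda>i. Poly_Mapping.single (a i) (1::'k)) f) d =
    csum (part (\<lambda>m. sdeg n a m = d) f)"
proof -
  have "alg_hom n (\<lambda>i. Poly_Mapping.single (a i) (1::'k)) f =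
      (\<Sum>m\<in>keys f. Poly_Mapping.single (sdeg n a m) (lookup f m))"
    unfolding alg_hom_def by (simp add: single_power prod_single mult_single sdeg_def)
  then have "lookup (alg_hom n (\<lambda>i. Poly_Mapping.single (a i) (1::'k)) f) d =
      (\<Sum>m\<in>keys f. lookup (part (\<lambda>m. sdeg n a m = d) f) m)"
    by (simp add: lookup_sum lookup_single lookup_part)
  also have "\<dots> = csum (part (\<lambda>m. sdeg n a m = d) f)"
    by (rule csum_superset[symmetric]) (auto simp: keys_part)
  finally show ?thesis .
qed

lemma toric_ideal_iff:
  "f \<in> toric_ideal n a \<longleftrightarrow> f \<in> polys {1..n} \<and> (\<forall>d. csum (part (\<lambda>m. sdeg n a m = d) f) = 0)"
  by (simp add: toric_ideal_def poly_mapping_eq_iff fun_eq_iff lookup_alg_hom)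

text \<open>Only one degree occurs, so a single coefficient sum has to vanish. The degree is
  \<open>s\<close> minus an offset \<open>b\<close>, written additively because subtraction is
  truncated on \<open>nat^3\<close>.\<close>

lemma toric_ideal_homogeneous_iff:
  assumes "f \<in> polys {1..n}" "\<And>m. m \<in> keys f \<Longrightarrow> sdeg n a m + b = s"
  shows "f \<in> toric_ideal n a \<longleftrightarrow> csum f = 0"
proof (cases "f = 0")
  case True
  then show ?thesis
    by (simp add: toric_ideal_iff)
next
  case False
  then obtain m0 where m0: "m0 \<in> keys f"
    by (metis keys_eq_empty ex_in_conv)
  have deg: "sdeg n a m = sdeg n a m0" if "m \<in> keys f" for m
    using assms(2)[OF that] assms(2)[OF m0] by (metis add_right_cancel)
  have "part (\<lambda>m. sdeg n a m = d) f = (if d = sdeg n a m0 then f else 0)" for d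
    by (auto intro!: part_id part_eq_0 simp: deg)
  then show ?thesis
    using assms(1) by (simp add: toric_ideal_iff)
qed

lemma csum_part_toric_ideal:
  assumes "f \<in> toric_ideal n a"
  shows "csum (part (\<lambda>m. sdeg n a m + b = s) f) = 0"
proof (cases "\<exists>d. d + b = s")
  case True
  then obtain d where "d + b = s" ..
  then have "(\<lambda>m. sdeg n a m + b = s) = (\<lambda>m. sdeg n a m = d)"
    by (metis add_right_cancel)
  then show ?thesis
    using assms by (simp add: toric_ideal_iff)
next
  \<comment> \<open>The difference of \<open>s\<close> and \<open>b\<close> would leave
    \<open>nat^3\<close>, so no term is selected.\<close>
  case False
  then have "part (\<lambda>m. sdeg n a m + b = s) f = 0"
    by (intro part_eq_0) blast
  then show ?thesis
    by simp
qed

section \<open>The monomial order on a fibre of the degree map\<close>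

lemma omega_deg_eq_sdeg: "omega_deg n a m = (\<Sum>j\<in>UNIV. sdeg n a m $ j)"
proof -
  have "omega_deg n a m = (\<Sum>i\<in>{1..n}. \<Sum>j\<in>UNIV. lookup m i * a i $ j)"
    by (simp add: omega_deg_def omega_def sum_distrib_left mult.commute)
  also have "\<dots> = (\<Sum>j\<in>UNIV. \<Sum>i\<in>{1..n}. lookup m i * a i $ j)"
    by (rule sum.swap)
  finally show ?thesis
    by (simp add: sdeg_component)
qed

text \<open>Equal degrees force equal weights, leaving the reverse lexicographic tie-break.\<close>

lemma revlex_gt_same_sdeg:
  assumes "sdeg n a m = sdeg n a m'"
  shows "revlex_gt n a m m' \<longleftrightarrow>
    (\<exists>i\<in>{1..n}. lookup m i < lookup m' i \<and> (\<forall>j\<in>{i<..n}. lookup m j = lookup m' j))"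
  using assms by (simp add: revlex_gt_def omega_deg_eq_sdeg)

lemma revlex_gt_irrefl: "\<not> revlex_gt n a m m"
  by (simp add: revlex_gt_def)

lemma revlex_gt_add: "revlex_gt n a (m + r) (m' + r) \<longleftrightarrow> revlex_gt n a m m'"
  by (simp add: revlex_gt_def omega_deg_eq_sdeg sdeg_add lookup_add sum.distrib)

lemma revlex_gt_total:
  assumes "sdeg n a m = sdeg n a m'" "keys m \<subseteq> {1..n}" "keys m' \<subseteq> {1..n}" "m \<noteq> m'"
  shows "revlex_gt n a m m' \<or> revlex_gt n a m' m"
proof -
  define D where "D = {i. lookup m i \<noteq> lookup m' i}"
  have "D \<subseteq> {1..n}"
  proof
    fix i assume "i \<in> D"
    then have "i \<in> keys m \<union> keys m'"
      unfolding D_def in_keys_iff Un_iff by auto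
    then show "i \<in> {1..n}"
      using assms by blast
  qed
  then have fin: "finite D"
    by (rule finite_subset) simp
  have "D \<noteq> {}"
    using assms(4) by (auto simp: D_def poly_mapping_eq_iff fun_eq_iff)
  \<comment> \<open>The last index at which the exponents differ decides the comparison.\<close>
  define i where "i = Max D"
  have "i \<in> D"
    unfolding i_def by (rule Max_in) fact+
  have "lookup m j = lookup m' j" if "j > i" for j
  proof -
    have "j \<notin> D"
      using Max_ge[OF fin, of j] that unfolding i_def[symmetric] by auto
    then show ?thesis
      by (simp add: D_def)
  qed
  then have "\<forall>j\<in>{i<..n}. lookup m j = lookup m' j"
    by simp
  moreover have "lookup m i < lookup m' i \<or> lookup m' i < lookup m i"
    using \<open>i \<in> D\<close> unfolding D_def by auto
  moreover have "i \<in> {1..n}"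
    using \<open>i \<in> D\<close> \<open>D \<subseteq> {1..n}\<close> ..
  ultimately show ?thesis
    unfolding revlex_gt_same_sdeg[OF assms(1)] revlex_gt_same_sdeg[OF assms(1)[symmetric]]
    by metis
qed

section \<open>Standard monomials and the initial ideal\<close>

text \<open>The toric ideal is spanned by the binomials whose two monomials have the same degree, so the only
  monomial of a fibre of \<^const>\<open>sdeg\<close> outside the initial ideal is the smallest one.\<close>

definition reducible :: "nat \<Rightarrow> (nat \<Rightarrow> nat^3) \<Rightarrow> mono \<Rightarrow> bool" where
  "reducible n a m \<longleftrightarrow>
    (\<exists>m'. keys m' \<subseteq> {1..n} \<and> sdeg n a m' = sdeg n a m \<and> revlex_gt n a m m')"

lemma reducible_add:
  assumes "reducible n a m" "keys r \<subseteq> {1..n}"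
  shows "reducible n a (m + r)"
proof -
  obtain m' where "keys m' \<subseteq> {1..n}" "sdeg n a m' = sdeg n a m" "revlex_gt n a m m'"
    using assms(1) unfolding reducible_def by blast
  then show ?thesis
    unfolding reducible_def using assms(2)
    by (intro exI[of _ "m' + r"]) (simp add: keys_mono_add sdeg_add revlex_gt_add)
qed

lemma binomial_in_toric_ideal:
  assumes "keys m \<subseteq> {1..n}" "keys m' \<subseteq> {1..n}" "sdeg n a m = sdeg n a m'"
  shows "(mon m - mon m' :: 'k::field mpoly) \<in> toric_ideal n a"
proof -
  have "keys (mon m - mon m' :: 'k mpoly) \<subseteq> {m, m'}"
    using keys_diff[of "mon m" "mon m'"] by auto
  then show ?thesis
    by (subst toric_ideal_homogeneous_iff[where b = 0 and s = "sdeg n a m"])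
      (use assms in \<open>auto simp: csum_diff intro!: polys_diff polys_single\<close>)
qed

lemma lead_mon_toric_ideal_reducible:
  fixes f :: "'k::field mpoly"
  assumes "f \<in> toric_ideal n a" "is_lead_mon n a f m"
  shows "keys m \<subseteq> {1..n}" "reducible n a m"
proof -
  have f: "f \<in> polys {1..n}" and m: "m \<in> keys f"
    using assms by (auto simp: toric_ideal_iff is_lead_mon_def)
  then show "keys m \<subseteq> {1..n}"
    by (rule polys_keysD)
  let ?g = "part (\<lambda>m'. sdeg n a m' = sdeg n a m) f"
  \<comment> \<open>If \<open>m\<close> were alone in its degree, its nonzero coefficient would be
    the coefficient sum there.\<close>
  have "\<exists>m'\<in>keys ?g. m' \<noteq> m"
  proof (rule ccontr)
    assume "\<not> ?thesis"
    then have "csum ?g = (\<Sum>m'\<in>{m}. lookup ?g m')"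
      by (intro csum_superset) auto
    then have "csum ?g \<noteq> 0"
      using m by (simp add: lookup_part in_keys_iff)
    then show False
      using assms(1) by (simp add: toric_ideal_iff)
  qed
  then obtain m' where "m' \<in> keys f" "sdeg n a m' = sdeg n a m" "m' \<noteq> m"
    by (auto simp: keys_part)
  then show "reducible n a m"
    using assms(2) polys_keysD[OF f] unfolding reducible_def is_lead_mon_def by blast
qed

text \<open>The leading monomials of the toric ideal are exactly the reducible ones in the given
  variables: a reducible \<open>m\<close> leads the binomial \<open>mon m - mon m'\<close>. As
  multiples of reducible monomials are reducible, the generated ideal contains no further
  monomials.\<close>

lemma init_ideal_iff:
  fixes f :: "'k::field mpoly"
  shows "f \<in> init_ideal n a (toric_ideal n a) \<longleftrightarrow>
    f \<in> polys {1..n} \<and> (\<forall>m\<in>keys f. reducible n a m)"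
proof -
  define G where "G = {m. \<exists>f\<in>toric_ideal n a :: 'k mpoly set. is_lead_mon n a f m}"
  have G: "m \<in> G \<longleftrightarrow> keys m \<subseteq> {1..n} \<and> reducible n a m" for m
  proof
    assume "keys m \<subseteq> {1..n} \<and> reducible n a m"
    then obtain m' where m': "keys m' \<subseteq> {1..n}" "sdeg n a m' = sdeg n a m" "revlex_gt n a m m'"
      and m: "keys m \<subseteq> {1..n}"
      unfolding reducible_def by blast
    have "m \<noteq> m'"
      using m'(3) revlex_gt_irrefl by metis
    then have "m \<in> keys (mon m - mon m' :: 'k mpoly)"
      by (simp add: in_keys_iff lookup_minus lookup_single)
    moreover have "keys (mon m - mon m' :: 'k mpoly) \<subseteq> {m, m'}"
      using keys_diff[of "mon m" "mon m'"] by auto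
    ultimately have "is_lead_mon n a (mon m - mon m' :: 'k mpoly) m"
      using m'(3) unfolding is_lead_mon_def by auto
    then show "m \<in> G"
      unfolding G_def using binomial_in_toric_ideal[OF m m'(1) m'(2)[symmetric]] by blast
  qed (use lead_mon_toric_ideal_reducible in \<open>unfold G_def, blast\<close>)
  have "init_ideal n a (toric_ideal n a) = ideal_of {1..n} (mon ` G :: 'k mpoly set)"
    unfolding init_ideal_def G_def by (rule arg_cong[of _ _ "ideal_of _"]) auto
  then have "f \<in> init_ideal n a (toric_ideal n a) \<longleftrightarrow>
      f \<in> polys {1..n} \<and> (\<forall>m\<in>keys f. \<exists>g\<in>G. \<exists>r. m = g + r)"
    using ideal_of_mon_iff[of G "{1..n}" f] G by simp
  also have "\<dots> \<longleftrightarrow> f \<in> polys {1..n} \<and> (\<forall>m\<in>keys f. reducible n a m)"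
  proof (intro conj_cong ball_cong refl)
    fix m assume "f \<in> polys {1..n}" "m \<in> keys f"
    then have m: "keys m \<subseteq> {1..n}"
      by (rule polys_keysD)
    show "(\<exists>g\<in>G. \<exists>r. m = g + r) \<longleftrightarrow> reducible n a m"
    proof
      assume "\<exists>g\<in>G. \<exists>r. m = g + r"
      then show "reducible n a m"
        using m reducible_add by (auto simp: G keys_mono_add)
    next
      assume "reducible n a m"
      then show "\<exists>g\<in>G. \<exists>r. m = g + r"
        using m by (intro bexI[of _ m] exI[of _ 0]) (auto simp: G)
    qed
  qed
  finally show ?thesis .
qed

lemma mon_in_init_ideal_iff:
  assumes "keys m \<subseteq> {1..n}"
  shows "(mon m :: 'k::field mpoly) \<in> init_ideal n a (toric_ideal n a) \<longleftrightarrow> reducible n a m"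
  using assms by (simp add: init_ideal_iff polys_single)

text \<open>In the degree of \<open>m\<close> the coefficients of an element of the toric ideal sum
  to 0, so the summand divisible by x_i must have a term there. Conversely, a binomial exchanges
  \<open>m\<close> for a monomial of the same degree divisible by x_i.\<close>

lemma mon_in_toric_plus_Var_iff:
  assumes m: "keys m \<subseteq> {1..n}" and i: "i \<in> {1..n}"
  shows "(mon m :: 'k::field mpoly) \<in> ideal_sum (toric_ideal n a) (ideal_of {1..n} {Var i}) \<longleftrightarrow>
    (\<exists>t\<in>affine_monoid n a. t + a i = sdeg n a m)"
proof
  assume "(mon m :: 'k mpoly) \<in> ideal_sum (toric_ideal n a) (ideal_of {1..n} {Var i})"
  then obtain f g :: "'k mpoly" where fg: "mon m = f + g" "f \<in> toric_ideal n a"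
    "g \<in> ideal_of {1..n} (Var ` {i})"
    unfolding ideal_sum_def by auto
  let ?p = "part (\<lambda>m'. sdeg n a m' = sdeg n a m)"
  have "csum (?p (mon m :: 'k mpoly)) = 1"
    by (subst part_id) auto
  moreover have "csum (?p f) = 0"
    using fg(2) by (simp add: toric_ideal_iff)
  ultimately have "csum (?p g) \<noteq> 0"
    unfolding fg(1) part_add csum_add by simp
  then obtain m' where m': "m' \<in> keys (?p g)"
    by (metis csum_zero keys_eq_empty ex_in_conv)
  then have "keys m' \<subseteq> {1..n}" "i \<in> keys m'"
    using fg(3) ideal_of_Vars_iff[of "{i}" "{1..n}" g] i by (auto simp: keys_part dest: polys_keysD)
  moreover from this obtain r where r: "m' = Poly_Mapping.single i 1 + r"
    using single_dvd_iff by blast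
  ultimately have "sdeg n a r \<in> affine_monoid n a"
    unfolding affine_monoid_iff by (auto simp: keys_mono_add)
  moreover have "sdeg n a r + a i = sdeg n a m"
    using m' unfolding r keys_part by (simp only: sdeg_add sdeg_Var[OF i] mem_Collect_eq add.commute)
  ultimately show "\<exists>t\<in>affine_monoid n a. t + a i = sdeg n a m" ..
next
  assume "\<exists>t\<in>affine_monoid n a. t + a i = sdeg n a m"
  then obtain r where r: "keys r \<subseteq> {1..n}" "sdeg n a r + a i = sdeg n a m"
    by (auto simp: affine_monoid_iff)
  define m' where "m' = r + Poly_Mapping.single i 1"
  have m': "keys m' \<subseteq> {1..n}" "sdeg n a m = sdeg n a m'" "i \<in> keys m'"
    unfolding m'_def using r i by (simp_all only: keys_mono_add sdeg_add sdeg_Var) auto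
  have "(mon m' :: 'k mpoly) \<in> ideal_of {1..n} (Var ` {i})"
    using m' i by (subst ideal_of_Vars_iff) (auto simp: polys_single)
  moreover have "(mon m - mon m' :: 'k mpoly) \<in> toric_ideal n a"
    by (rule binomial_in_toric_ideal) (use m m' in auto)
  moreover have "(mon m :: 'k mpoly) = (mon m - mon m') + mon m'"
    by simp
  ultimately show "(mon m :: 'k mpoly) \<in> ideal_sum (toric_ideal n a) (ideal_of {1..n} {Var i})"
    unfolding ideal_sum_def image_insert image_empty by blast
qed

section \<open>The second syzygies as corners of staircases\<close>

lemma mono_dvd_iff: "(\<exists>r. (m'::mono) = m + r) \<longleftrightarrow> (\<forall>i. lookup m i \<le> lookup m' i)"
proof
  assume "\<forall>i. lookup m i \<le> lookup m' i"
  then have "m' = m + (m' - m)"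
    by (intro poly_mapping_eqI) (simp add: lookup_add lookup_minus)
  then show "\<exists>r. m' = m + r" ..
qed (auto simp: lookup_add)

lemma last3_subset: "3 \<le> n \<Longrightarrow> last3 n \<subseteq> {1..n}"
  by auto

lemma min_gens_dvd:
  assumes "sorted_min_gens n (K :: 'k::field mpoly set) Ms" "keys M \<subseteq> last3 n"
  shows "mon M \<in> K \<longleftrightarrow> (\<exists>N\<in>set Ms. \<forall>i. lookup N i \<le> lookup M i)"
proof -
  have "K = ideal_of (last3 n) (mon ` set Ms)" "\<And>N. N \<in> set Ms \<Longrightarrow> keys N \<subseteq> last3 n"
    using assms(1) unfolding sorted_min_gens_def by auto
  then show ?thesis
    using assms(2) ideal_of_mon_iff[of "set Ms" "last3 n" "mon M :: 'k mpoly"]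
    by (simp add: polys_single mono_dvd_iff)
qed

text \<open>A generator properly divisible by another one could be dropped without changing the
  ideal, against minimality.\<close>

lemma min_gens_antichain:
  assumes gens: "sorted_min_gens n (K :: 'k::field mpoly set) Ms"
    and N: "N \<in> set Ms" "N' \<in> set Ms" "\<And>i. lookup N i \<le> lookup N' i"
  shows "N = N'"
proof (rule ccontr)
  assume "N \<noteq> N'"
  define T where "T = set Ms - {N'}"
  have K: "K = ideal_of (last3 n) (mon ` set Ms)"
    and keys: "\<And>N. N \<in> set Ms \<Longrightarrow> keys N \<subseteq> last3 n"
    using gens unfolding sorted_min_gens_def by auto
  have T: "N \<in> T" "T \<subset> set Ms"
    using N \<open>N \<noteq> N'\<close> by (auto simp: T_def)
  have eq: "(\<exists>g\<in>T. \<forall>i. lookup g i \<le> lookup m i) \<longleftrightarrow> (\<exists>g\<in>set Ms. \<forall>i. lookup g i \<le> lookup m i)" for m :: mono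
    using T N(3) unfolding T_def by (metis Diff_iff order_trans singletonD)
  have keys_T: "\<And>N. N \<in> T \<Longrightarrow> keys N \<subseteq> last3 n"
    using T keys by blast
  have "f \<in> ideal_of (last3 n) (mon ` T) \<longleftrightarrow> f \<in> ideal_of (last3 n) (mon ` set Ms)" for f :: "'k mpoly"
    using ideal_of_mon_iff[of T "last3 n" f, OF keys_T] ideal_of_mon_iff[of "set Ms" "last3 n" f, OF keys]
    by (simp add: mono_dvd_iff eq)
  then have "ideal_of (last3 n) (mon ` T) = K"
    unfolding K by blast
  then show False
    using gens T(2) unfolding sorted_min_gens_def by blast
qed

text \<open>The characteristic feature of the reverse lexicographic order: a smaller monomial of the
  same degree contains x_n at least as often, so x_n cancels from both.\<close>

lemma reducible_cancel_last:
  assumes "1 \<le> n" and red: "reducible n a (m + Poly_Mapping.single n 1)"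
  shows "reducible n a m"
proof -
  obtain m' where m': "keys m' \<subseteq> {1..n}" "sdeg n a m' = sdeg n a (m + Poly_Mapping.single n 1)"
    "revlex_gt n a (m + Poly_Mapping.single n 1) m'"
    using red unfolding reducible_def by blast
  then obtain i where i: "i \<in> {1..n}" "lookup (m + Poly_Mapping.single n 1) i < lookup m' i"
    "\<forall>j\<in>{i<..n}. lookup (m + Poly_Mapping.single n 1) j = lookup m' j"
    using revlex_gt_same_sdeg[OF m'(2)[symmetric]] by blast
  have "lookup (m + Poly_Mapping.single n 1) n \<le> lookup m' n"
    by (cases "i = n") (use i in auto)
  then have "n \<in> keys m'"
    by (simp add: in_keys_iff lookup_add)
  then obtain r where r: "m' = Poly_Mapping.single n 1 + r"
    using single_dvd_iff by blast
  have "keys r \<subseteq> {1..n}" "sdeg n a r = sdeg n a m" "revlex_gt n a m r"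
    using m' unfolding r add.commute[of "Poly_Mapping.single n 1"]
    by (simp_all add: keys_mono_add sdeg_add revlex_gt_add)
  then show ?thesis
    unfolding reducible_def by blast
qed

text \<open>Take a smaller \<open>v\<close> in the degree of
  \<open>c + Poly_Mapping.single (n - 1) 1\<close>. If x_n did not divide \<open>v\<close>, the
  order would force x_{n-1} to divide it, and cancelling x_{n-1} would make \<open>c\<close>
  reducible. Hence x_n divides \<open>v\<close>, and the quotient has degree
  \<open>t\<close>.\<close>

lemma reducible_last_factor:
  assumes "2 \<le> n" "keys c \<subseteq> {1..n}" "lookup c n = 0" "\<not> reducible n a c"
    and red: "reducible n a (c + Poly_Mapping.single (n - 1) 1)"
  shows "\<exists>t\<in>affine_monoid n a. t + a n = sdeg n a c + a (n - 1)"
proof -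
  let ?w = "c + Poly_Mapping.single (n - 1) 1"
  have w: "sdeg n a ?w = sdeg n a c + a (n - 1)"
    using \<open>2 \<le> n\<close> by (subst sdeg_add, subst sdeg_Var) auto
  have wn: "lookup ?w n = 0" "lookup ?w (n - 1) \<ge> 1"
    using assms(1,3) by (simp_all add: lookup_add lookup_single)
  obtain v where v: "keys v \<subseteq> {1..n}" "sdeg n a v = sdeg n a ?w" "revlex_gt n a ?w v"
    using red unfolding reducible_def by blast
  then obtain i where i: "i \<in> {1..n}" "lookup ?w i < lookup v i"
    "\<forall>j\<in>{i<..n}. lookup ?w j = lookup v j"
    using revlex_gt_same_sdeg[OF v(2)[symmetric]] by blast
  have "n \<in> keys v"
  proof (rule ccontr)
    assume "n \<notin> keys v"
    then have "lookup v n = 0"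
      by (simp add: in_keys_iff)
    then have "i \<noteq> n"
      using i(2) by auto
    then have "lookup v (n - 1) \<ge> 1"
      using i wn(2) by (cases "i = n - 1") auto
    then have "n - 1 \<in> keys v"
      by (simp add: in_keys_iff)
    then obtain r where r: "v = Poly_Mapping.single (n - 1) 1 + r"
      using single_dvd_iff by blast
    have "keys r \<subseteq> {1..n}" "sdeg n a r = sdeg n a c" "revlex_gt n a c r"
      using v unfolding r add.commute[of "Poly_Mapping.single (n - 1) 1"]
      by (simp_all add: keys_mono_add sdeg_add revlex_gt_add)
    then show False
      using assms(4) unfolding reducible_def by blast
  qed
  then obtain r where r: "v = Poly_Mapping.single n 1 + r"
    using single_dvd_iff by blast
  have "sdeg n a r \<in> affine_monoid n a"
    using v(1) unfolding r affine_monoid_iff by (auto simp: keys_mono_add)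
  moreover have "sdeg n a r + a n = sdeg n a v"
    unfolding r using \<open>2 \<le> n\<close> by (subst sdeg_add, subst sdeg_Var) (auto simp: add.commute)
  ultimately show ?thesis
    using v(2) w by metis
qed

text \<open>Otherwise a monomial divisible by x_n would lie in the degree of \<open>c\<close>; being
  free of x_n, \<open>c\<close> would be larger and so reducible.\<close>

lemma irreducible_not_shifted:
  assumes "1 \<le> n" "lookup c n = 0" "\<not> reducible n a c" "t \<in> affine_monoid n a"
  shows "t + a n \<noteq> sdeg n a c"
proof
  assume eq: "t + a n = sdeg n a c"
  obtain r where r: "keys r \<subseteq> {1..n}" "sdeg n a r = t"
    using assms(4) by (auto simp: affine_monoid_iff)
  let ?v = "r + Poly_Mapping.single n 1"
  have v: "sdeg n a ?v = sdeg n a c"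
    using \<open>1 \<le> n\<close> r eq by (subst sdeg_add, subst sdeg_Var) auto
  have "revlex_gt n a c ?v"
    unfolding revlex_gt_same_sdeg[OF v[symmetric]]
    by (rule bexI[of _ n]) (use assms in \<open>auto simp: lookup_add\<close>)
  moreover have "keys ?v \<subseteq> {1..n}"
    using r(1) \<open>1 \<le> n\<close> by (simp add: keys_mono_add)
  ultimately show False
    using assms(3) v unfolding reducible_def by blast
qed

lemma irreducible_unique:
  assumes "\<not> reducible n a m" "\<not> reducible n a m'" "sdeg n a m = sdeg n a m'"
    and "keys m \<subseteq> {1..n}" "keys m' \<subseteq> {1..n}"
  shows "m = m'"
  using assms revlex_gt_total[OF assms(3-5)] unfolding reducible_def by metis

section \<open>Generators of \<open>I_u\<close> and the corners of their staircase\<close>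

lemma B0J_keys:
  assumes "3 \<le> n" "u \<in> B0J n (init_ideal n a (toric_ideal n a) :: 'k::field mpoly set)"
  shows "keys u \<subseteq> {1..n}" "keys u \<inter> last3 n = {}"
proof -
  let ?L = "init_ideal n a (toric_ideal n a) :: 'k mpoly set"
  have u: "keys u \<subseteq> {1..n}" "mon u \<notin> ideal_sum ?L (ideal_of {1..n} (Var ` last3 n))"
    using assms(2) by (auto simp: B0J_def B0_def)
  then show "keys u \<subseteq> {1..n}" by simp
  show "keys u \<inter> last3 n = {}"
  proof (rule ccontr)
    assume "keys u \<inter> last3 n \<noteq> {}"
    then have "(mon u :: 'k mpoly) \<in> ideal_of {1..n} (Var ` last3 n)"
      using u(1) by (subst ideal_of_Vars_iff[OF last3_subset[OF assms(1)]]) (simp add: polys_single)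
    moreover have "(0 :: 'k mpoly) \<in> ?L"
      by (simp add: init_ideal_iff)
    moreover have "mon u = 0 + (mon u :: 'k mpoly)"
      by simp
    ultimately show False
      using u(2) unfolding ideal_sum_def by blast
  qed
qed

lemma mon_in_I_u_iff:
  assumes "3 \<le> n" "keys u \<subseteq> {1..n}"
  shows "(mon M :: 'k::field mpoly) \<in> I_u n (init_ideal n a (toric_ideal n a)) u \<longleftrightarrow>
    keys M \<subseteq> last3 n \<and> reducible n a (u + M)"
proof (cases "keys M \<subseteq> last3 n")
  case True
  then have "keys (u + M) \<subseteq> {1..n}"
    using assms(2) last3_subset[OF assms(1)] unfolding keys_mono_add by (metis Un_least order_trans)
  then show ?thesis
    using True by (simp add: I_u_def polys_single mult_single mon_in_init_ideal_iff)
qed (auto simp: I_u_def polys_def)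

text \<open>The generators of \<open>I_u\<close> form a staircase in the exponents of x_{n-2} and
  x_{n-1}, and the lcm of two neighbours marks the corner between them: lowering both exponents by
  one leaves the ideal, while lowering only the first still gives a multiple of the earlier
  generator.\<close>

lemma B2'_corner:
  fixes n :: nat and a :: "nat \<Rightarrow> nat^3"
  defines "L \<equiv> init_ideal n a (toric_ideal n a) :: 'k::field mpoly set"
  assumes n: "3 \<le> n" and m: "m \<in> B2' n L"
  obtains u \<alpha> \<beta> where
    "m = u + Poly_Mapping.single (n - 2) \<alpha> + Poly_Mapping.single (n - 1) \<beta>"
    "u \<in> B0J n L" "\<alpha> \<ge> 1" "\<beta> \<ge> 1"
    "\<not> reducible n a (u + Poly_Mapping.single (n - 2) (\<alpha> - 1) + Poly_Mapping.single (n - 1) (\<beta> - 1))"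
    "reducible n a (u + Poly_Mapping.single (n - 2) (\<alpha> - 1) + Poly_Mapping.single (n - 1) \<beta>)"
proof -
  obtain u Ms i where u: "u \<in> B0J n L" and gens: "sorted_min_gens n (I_u n L u) Ms"
    and i: "Suc i < length Ms" and m_eq: "m = u + mono_lcm (Ms ! i) (Ms ! Suc i)"
    using m unfolding B2'_def by blast
  have keys_u: "keys u \<subseteq> {1..n}"
    using B0J_keys[OF n] u unfolding L_def by blast
  have red_iff: "reducible n a (u + M) \<longleftrightarrow> (\<exists>N\<in>set Ms. \<forall>i. lookup N i \<le> lookup M i)"
    if "keys M \<subseteq> last3 n" for M
    using that mon_in_I_u_iff[OF n keys_u, of M a, where 'k = 'k] min_gens_dvd[OF gens that]
    unfolding L_def by simp
  have keys: "keys N \<subseteq> last3 n" if "N \<in> set Ms" for N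
    using gens that unfolding sorted_min_gens_def by blast
  have lookup_0: "lookup N j = 0" if "N \<in> set Ms" "j \<notin> last3 n" for N j
    using keys[OF that(1)] that(2) by (auto simp: in_keys_iff subset_iff)
  \<comment> \<open>A generator divisible by x_n could be divided by it and stay in
    \<open>I_u\<close>, so another generator would properly divide it.\<close>
  have z_free: "lookup N n = 0" if N: "N \<in> set Ms" for N
  proof (rule ccontr)
    assume "lookup N n \<noteq> 0"
    then obtain r where r: "N = Poly_Mapping.single n 1 + r"
      using single_dvd_iff in_keys_iff by metis
    have "reducible n a (u + N)"
      using red_iff[OF keys[OF N]] N by blast
    moreover have "u + N = u + r + Poly_Mapping.single n 1"
      by (simp add: r algebra_simps)
    ultimately have "reducible n a (u + r + Poly_Mapping.single n 1)"
      by (simp only:)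
    then have "reducible n a (u + r)"
      by (rule reducible_cancel_last[rotated]) (use n in simp)
    moreover have "keys r \<subseteq> last3 n"
      using keys[OF N] unfolding r by (simp add: keys_mono_add)
    ultimately obtain N' where N': "N' \<in> set Ms" "\<And>i. lookup N' i \<le> lookup r i"
      using red_iff by blast
    have "lookup N' i \<le> lookup N i" for i
      using N'(2)[of i] by (simp add: r lookup_add)
    then have "N' = N"
      by (rule min_gens_antichain[OF gens N'(1) N])
    then show False
      using N'(2)[of n] by (simp add: r lookup_add)
  qed
  have lookup_other: "lookup N j = 0" if "N \<in> set Ms" "j \<noteq> n - 2" "j \<noteq> n - 1" for N j
    using lookup_0[OF that(1), of j] z_free[OF that(1)] that by (cases "j = n") auto
  have leI: "\<forall>j. lookup N j \<le> lookup M j"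
    if "N \<in> set Ms" "lookup N (n - 2) \<le> lookup M (n - 2)" "lookup N (n - 1) \<le> lookup M (n - 1)" for N M
  proof
    fix j
    show "lookup N j \<le> lookup M j"
      using that lookup_other[OF that(1), of j] by (cases "j = n - 2"; cases "j = n - 1") auto
  qed
  \<comment> \<open>Neither generator divides the other and x_n is absent, so along the
    lexicographically decreasing list one exponent strictly falls while the other strictly
    rises.\<close>
  have step: "lookup (Ms ! j) (n - 1) > lookup (Ms ! k) (n - 1) \<and>
      lookup (Ms ! j) (n - 2) < lookup (Ms ! k) (n - 2)" if jk: "j < k" "k < length Ms" for j k
  proof -
    have in_Ms: "Ms ! j \<in> set Ms" "Ms ! k \<in> set Ms"
      using jk by auto
    have gt: "lex_gt n (Ms ! j) (Ms ! k)"
      using gens jk sorted_wrt_nth_less[of "lex_gt n" Ms j k] unfolding sorted_min_gens_def by simp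
    then have "Ms ! j \<noteq> Ms ! k"
      by (auto simp: lex_gt_def)
    then have "\<not> (\<forall>i. lookup (Ms ! j) i \<le> lookup (Ms ! k) i)" "\<not> (\<forall>i. lookup (Ms ! k) i \<le> lookup (Ms ! j) i)"
      using min_gens_antichain[OF gens in_Ms] min_gens_antichain[OF gens in_Ms(2,1)] by auto
    then have "\<not> (lookup (Ms ! j) (n - 2) \<le> lookup (Ms ! k) (n - 2) \<and>
          lookup (Ms ! j) (n - 1) \<le> lookup (Ms ! k) (n - 1))"
        "\<not> (lookup (Ms ! k) (n - 2) \<le> lookup (Ms ! j) (n - 2) \<and>
          lookup (Ms ! k) (n - 1) \<le> lookup (Ms ! j) (n - 1))"
      using leI[OF in_Ms(1), of "Ms ! k"] leI[OF in_Ms(2), of "Ms ! j"] by blast+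
    then show ?thesis
      using gt z_free[OF in_Ms(1)] z_free[OF in_Ms(2)] unfolding lex_gt_def by auto
  qed
  \<comment> \<open>In the lcm of neighbours the exponent of x_{n-2} comes from the later generator
    and that of x_{n-1} from the earlier one.\<close>
  define \<alpha> \<beta> where "\<alpha> = lookup (Ms ! Suc i) (n - 2)" and "\<beta> = lookup (Ms ! i) (n - 1)"
  have pos: "\<alpha> \<ge> 1" "\<beta> \<ge> 1"
    using step[of i "Suc i"] i unfolding \<alpha>_def \<beta>_def by auto
  have Mi: "Ms ! i \<in> set Ms" "Ms ! Suc i \<in> set Ms"
    using i by auto
  define c where "c k l = Poly_Mapping.single (n - 2) k + Poly_Mapping.single (n - 1) l" for k l :: nat
  have lookup_c: "lookup (c k l) (n - 2) = k" "lookup (c k l) (n - 1) = l" for k l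
    using n by (auto simp: c_def lookup_add lookup_single when_def)
  have keys_c: "keys (c k l) \<subseteq> last3 n" for k l
    by (auto simp: c_def keys_mono_add)
  have "mono_lcm (Ms ! i) (Ms ! Suc i) = c \<alpha> \<beta>"
  proof (rule poly_mapping_eqI)
    fix j
    consider "j = n - 2" | "j = n - 1" | "j \<noteq> n - 2" "j \<noteq> n - 1" by blast
    then show "lookup (mono_lcm (Ms ! i) (Ms ! Suc i)) j = lookup (c \<alpha> \<beta>) j"
    proof cases
      case 3
      then have "lookup (Ms ! i) j = 0" "lookup (Ms ! Suc i) j = 0"
        using lookup_other[OF Mi(1)] lookup_other[OF Mi(2)] by auto
      with 3 show ?thesis
        by (simp add: lookup_mono_lcm c_def lookup_add lookup_single)
    next
      case 1
      show ?thesis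
        unfolding 1 lookup_mono_lcm lookup_c \<alpha>_def using step[of i "Suc i"] i by simp
    next
      case 2
      show ?thesis
        unfolding 2 lookup_mono_lcm lookup_c \<beta>_def using step[of i "Suc i"] i by simp
    qed
  qed
  then have m_split: "m = u + Poly_Mapping.single (n - 2) \<alpha> + Poly_Mapping.single (n - 1) \<beta>"
    unfolding m_eq c_def by (simp add: add.assoc)
  have irred: "\<not> reducible n a (u + c (\<alpha> - 1) (\<beta> - 1))"
  proof
    assume "reducible n a (u + c (\<alpha> - 1) (\<beta> - 1))"
    then obtain N where N: "N \<in> set Ms" "\<forall>i. lookup N i \<le> lookup (c (\<alpha> - 1) (\<beta> - 1)) i"
      using red_iff[OF keys_c] by blast
    then have "lookup N (n - 2) \<le> \<alpha> - 1" "lookup N (n - 1) \<le> \<beta> - 1"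
      using lookup_c by metis+
    then have lt: "lookup N (n - 2) < \<alpha>" "lookup N (n - 1) < \<beta>"
      using pos by linarith+
    obtain j where j: "j < length Ms" "N = Ms ! j"
      using N(1) by (metis in_set_conv_nth)
    \<comment> \<open>Generators up to index \<open>i\<close> have x_{n-1}-exponent at least
      \<open>\<beta>\<close>, those from \<open>Suc i\<close> on have x_{n-2}-exponent at least
      \<open>\<alpha>\<close>; none stays below both bounds.\<close>
    consider "j < i" | "j = i" | "j = Suc i" | "Suc i < j" by linarith
    then show False
      by cases (use step[of j i] step[of "Suc i" j] lt i j in \<open>auto simp: \<alpha>_def \<beta>_def\<close>)
  qed
  have red: "reducible n a (u + c (\<alpha> - 1) \<beta>)"
  proof -
    have "lookup (Ms ! i) (n - 2) \<le> \<alpha> - 1"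
      using step[of i "Suc i"] i unfolding \<alpha>_def by auto
    then have "\<forall>j. lookup (Ms ! i) j \<le> lookup (c (\<alpha> - 1) \<beta>) j"
      by (intro leI Mi) (simp_all only: lookup_c, simp add: \<beta>_def)
    then show ?thesis
      using red_iff[OF keys_c] Mi(1) by blast
  qed
  show ?thesis
    by (rule that[OF m_split u pos irred[unfolded c_def, folded add.assoc]
          red[unfolded c_def, folded add.assoc]])
qed

section \<open>Koszul complexes of free modules\<close>

text \<open>Rewriting \<open>1\<close> to \<open>Suc 0\<close> would destroy the patterns of \<^const>\<open>Poly_Mapping.single\<close> behind
  \<open>Var\<close> and \<open>last3\<close>.\<close>

declare One_nat_def [simp del]

definition vec_quot :: "nat \<Rightarrow> (nat \<Rightarrow> 'k::field mpoly) \<Rightarrow> nat \<Rightarrow> 'k mpoly" where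
  "vec_quot i v = (\<lambda>q. vquot i (v q))"

text \<open>A constant function, so that the pointwise product is multiplication of a vector by a
  scalar.\<close>

abbreviation vec_Var :: "nat \<Rightarrow> nat \<Rightarrow> 'k::field mpoly" where
  "vec_Var i \<equiv> (\<lambda>_. Var i)"

lemma vec_quot_zero: "vec_quot i 0 = 0"
  by (rule ext) (simp add: vec_quot_def)

lemma vec_quot_add: "vec_quot i (u + v) = vec_quot i u + vec_quot i v"
  by (rule ext) (simp add: vec_quot_def vquot_add)

lemma vec_quot_Var_same: "vec_quot i (vec_Var i * v) = v"
  by (rule ext) (simp add: vec_quot_def vquot_Var_same)

lemma vec_quot_Var_other: "i \<noteq> j \<Longrightarrow> vec_quot i (vec_Var j * v) = vec_Var j * vec_quot i v"
  by (rule ext) (simp add: vec_quot_def vquot_Var_other)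

lemma free_mod_add: "u \<in> free_mod V r \<Longrightarrow> v \<in> free_mod V r \<Longrightarrow> u + v \<in> free_mod V r"
  by (simp add: free_mod_def polys_add)

lemma free_mod_diff: "u \<in> free_mod V r \<Longrightarrow> v \<in> free_mod V r \<Longrightarrow> u - v \<in> free_mod V r"
  by (simp add: free_mod_def polys_diff)

lemma free_mod_uminus: "v \<in> free_mod V r \<Longrightarrow> - v \<in> free_mod V r"
  by (simp add: free_mod_def fun_Compl_def polys_uminus)

lemma free_mod_Var: "i \<in> V \<Longrightarrow> v \<in> free_mod V r \<Longrightarrow> vec_Var i * v \<in> free_mod V r"
  by (simp add: free_mod_def polys_mult polys_Var)

lemma free_mod_vec_quot: "v \<in> free_mod V r \<Longrightarrow> vec_quot i v \<in> free_mod V r"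
  by (simp add: free_mod_def vec_quot_def polys_vquot)

lemmas free_mod_closed = free_mod_add free_mod_diff free_mod_uminus free_mod_Var free_mod_vec_quot

lemma free_mod_polys: "v \<in> free_mod V r \<Longrightarrow> v q \<in> polys V"
  by (cases "q < r") (auto simp: free_mod_def)

text \<open>Two variables form a regular sequence. Dividing the equation by x_j expresses
  \<open>v\<close> through the quotient of \<open>u\<close>; after substitution x_i cancels.\<close>

lemma koszul_exact_2:
  assumes "i \<noteq> j" and eq: "vec_Var i * u = vec_Var j * v"
  shows "u = vec_Var j * vec_quot j u"
proof -
  have "v = vec_Var i * vec_quot j u"
    using arg_cong[OF eq, of "vec_quot j"] assms(1)
    by (simp only: vec_quot_Var_same vec_quot_Var_other not_sym)
  then have "vec_Var i * u = vec_Var i * (vec_Var j * vec_quot j u)"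
    using eq by (simp only: mult.left_commute)
  from arg_cong[OF this, of "vec_quot i"] show ?thesis
    by (simp only: vec_quot_Var_same)
qed

text \<open>Exactness of the Koszul complex on three variables. Dividing the relation by x_k
  recovers \<open>f3\<close> exactly and leaves a relation with coefficients x_i and x_j, which is
  the case of two variables.\<close>

lemma koszul_exact_1:
  assumes ijk: "i \<noteq> j" "i \<noteq> k" "j \<noteq> k" "k \<in> V"
    and f: "f1 \<in> free_mod V r" "f2 \<in> free_mod V r"
    and eq: "vec_Var i * f1 + vec_Var j * f2 + vec_Var k * f3 = 0"
  obtains g1 g2 g3 where "g1 \<in> free_mod V r" "g2 \<in> free_mod V r" "g3 \<in> free_mod V r"
    "f1 = vec_Var j * g3 - vec_Var k * g2" "f2 = vec_Var k * g1 - vec_Var i * g3"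
    "f3 = vec_Var i * g2 - vec_Var j * g1"
proof -
  define X Y Z :: "nat \<Rightarrow> 'a mpoly" where "X = vec_Var i" and "Y = vec_Var j" and "Z = vec_Var k"
  define g1 g2 where "g1 = vec_quot k f2" and "g2 = - vec_quot k f1"
  define g3 where "g3 = vec_quot j (f1 + Z * g2)"
  have g: "g1 \<in> free_mod V r" "g2 \<in> free_mod V r" "g3 \<in> free_mod V r"
    unfolding g1_def g2_def g3_def Z_def using f ijk(4)
    by (auto intro!: free_mod_closed)
  have "vec_quot k (X * f1 + Y * f2 + Z * f3) = 0"
    unfolding X_def Y_def Z_def eq by (rule vec_quot_zero)
  then have "X * vec_quot k f1 + Y * g1 + f3 = 0"
    unfolding X_def Y_def Z_def g1_def vec_quot_add vec_quot_Var_same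
      vec_quot_Var_other[OF ijk(2)[symmetric]] vec_quot_Var_other[OF ijk(3)[symmetric]] .
  then have "f3 = - (X * vec_quot k f1 + Y * g1)"
    unfolding add_eq_0_iff .
  then have f3: "f3 = X * g2 - Y * g1"
    by (simp only: g2_def mult_minus_right minus_add_distrib diff_conv_add_uminus)
  have "X * (f1 + Z * g2) - Y * (Z * g1 - f2) = X * f1 + Y * f2 + Z * f3"
    unfolding f3 by (simp add: algebra_simps)
  then have eq': "X * (f1 + Z * g2) = Y * (Z * g1 - f2)"
    using eq unfolding X_def Y_def Z_def by simp
  then have f1: "f1 + Z * g2 = Y * g3"
    using koszul_exact_2[OF ijk(1)] unfolding X_def Y_def g3_def by blast
  then have "Y * (X * g3) = Y * (Z * g1 - f2)"
    using eq' by (simp add: mult.left_commute)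
  from arg_cong[OF this, of "vec_quot j"] have f2: "X * g3 = Z * g1 - f2"
    unfolding Y_def by (simp only: vec_quot_Var_same)
  show ?thesis
    by (rule that[OF g]) (use f1 f2 f3 in \<open>simp_all only: X_def Y_def Z_def eq_diff_eq diff_eq_eq add.commute\<close>)
qed

text \<open>Division by the three variables in turn leaves only constant terms, which are
  zero.\<close>

lemma free_mod_maximal_ideal:
  assumes v: "v \<in> free_mod {i, j, k} r" and const: "\<And>q. lookup (v q) 0 = 0"
  obtains f1 f2 f3 where "f1 \<in> free_mod {i, j, k} r" "f2 \<in> free_mod {i, j, k} r" "f3 \<in> free_mod {i, j, k} r"
    "v = vec_Var i * f1 + vec_Var j * f2 + vec_Var k * f3"
proof -
  define f3 where "f3 = vec_quot k v"
  define v' where "v' = v - vec_Var k * f3"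
  define f2 where "f2 = vec_quot j v'"
  define v'' where "v'' = v' - vec_Var j * f2"
  define f1 where "f1 = vec_quot i v''"
  have f: "f3 \<in> free_mod {i, j, k} r" "f2 \<in> free_mod {i, j, k} r" "f1 \<in> free_mod {i, j, k} r"
    unfolding f1_def v''_def f2_def v'_def f3_def using v by (auto intro!: free_mod_closed)
  have l': "lookup (v' q) m = (if k \<in> keys m then 0 else lookup (v q) m)" for q m
    unfolding v'_def f3_def vec_quot_def fun_diff_def times_fun_apply lookup_vrem ..
  have l'': "lookup (v'' q) m = (if j \<in> keys m then 0 else lookup (v' q) m)" for q m
    unfolding v''_def f2_def vec_quot_def fun_diff_def times_fun_apply lookup_vrem ..
  have l: "lookup ((v'' - vec_Var i * f1) q) m = (if i \<in> keys m then 0 else lookup (v'' q) m)" for q m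
    unfolding f1_def vec_quot_def fun_diff_def times_fun_apply lookup_vrem ..
  have "v'' - vec_Var i * f1 = 0"
  proof (rule ext, rule poly_mapping_eqI)
    fix q m
    have "lookup (v q) m = 0" if "i \<notin> keys m" "j \<notin> keys m" "k \<notin> keys m"
    proof (rule ccontr)
      assume "lookup (v q) m \<noteq> 0"
      then have "keys m \<subseteq> {i, j, k}"
        using polys_keysD[OF free_mod_polys[OF v]] by (simp add: in_keys_iff)
      then have "keys m = {}"
        using that by blast
      then have "m = 0"
        by simp
      then show False
        using const \<open>lookup (v q) m \<noteq> 0\<close> by simp
    qed
    then show "lookup ((v'' - vec_Var i * f1) q) m = lookup (0 q) m"
      unfolding l l'' l' by simp
  qed
  then have "v = vec_Var i * f1 + vec_Var j * f2 + vec_Var k * f3"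
    unfolding v''_def v'_def by (simp add: algebra_simps)
  then show ?thesis
    using that f by blast
qed

section \<open>Homogeneous components of vectors\<close>

text \<open>The component of degree \<open>s - \<delta>\<close>; the pair \<open>s\<close>, \<open>\<delta>\<close> avoids the truncated subtraction of
  \<^typ>\<open>nat^3\<close>.\<close>

definition hcomp ::
  "nat \<Rightarrow> (nat \<Rightarrow> nat^3) \<Rightarrow> (nat \<Rightarrow> nat^3) \<Rightarrow> nat^3 \<Rightarrow> nat^3 \<Rightarrow> (nat \<Rightarrow> 'k::field mpoly) \<Rightarrow> nat \<Rightarrow> 'k mpoly" where
  "hcomp n a \<sigma> s \<delta> v = (\<lambda>q. part (\<lambda>m. sdeg n a m + \<sigma> q + \<delta> = s) (v q))"

lemma hcomp_add: "hcomp n a \<sigma> s \<delta> (u + v) = hcomp n a \<sigma> s \<delta> u + hcomp n a \<sigma> s \<delta> v"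
  by (rule ext) (simp add: hcomp_def part_add)

lemma hcomp_diff: "hcomp n a \<sigma> s \<delta> (u - v) = hcomp n a \<sigma> s \<delta> u - hcomp n a \<sigma> s \<delta> v"
  by (rule ext) (simp add: hcomp_def part_diff)

lemma hcomp_idem: "hcomp n a \<sigma> s \<delta> (hcomp n a \<sigma> s \<delta> v) = hcomp n a \<sigma> s \<delta> v"
  by (rule ext, rule poly_mapping_eqI) (simp add: hcomp_def lookup_part when_def)

lemma hcomp_Var:
  assumes "i \<in> {1..n}"
  shows "hcomp n a \<sigma> s \<delta> (vec_Var i * v) = vec_Var i * hcomp n a \<sigma> s (\<delta> + a i) v"
proof (rule ext)
  fix q
  have "part (\<lambda>m. sdeg n a m + \<sigma> q + \<delta> = s) (Var i * v q) =
      Var i * part (\<lambda>m. sdeg n a m + \<sigma> q + (\<delta> + a i) = s) (v q)"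
    by (rule part_mult) (simp add: sdeg_add sdeg_Var[OF assms] ac_simps)
  then show "hcomp n a \<sigma> s \<delta> (vec_Var i * v) q = (vec_Var i * hcomp n a \<sigma> s (\<delta> + a i) v) q"
    by (simp only: hcomp_def times_fun_apply)
qed

lemma free_mod_hcomp: "v \<in> free_mod V r \<Longrightarrow> hcomp n a \<sigma> s \<delta> v \<in> free_mod V r"
  by (simp add: free_mod_def hcomp_def polys_part)

lemma dmap_add: "dmap F j (u + v) = dmap F j u + dmap F j v"
  by (rule ext) (simp add: dmap_def distrib_left sum.distrib)

lemma dmap_diff: "dmap F j (u - v) = dmap F j u - dmap F j v"
  by (rule ext) (simp add: dmap_def right_diff_distrib sum_subtractf)

lemma dmap_Var: "dmap F j (vec_Var i * v) = vec_Var i * dmap F j v"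
  by (rule ext) (simp add: dmap_def sum_distrib_left mult.left_commute)

lemma aug_map_add: "aug_map F (u + v) = aug_map F u + aug_map F v"
  by (simp add: aug_map_def distrib_right sum.distrib)

lemma aug_map_diff: "aug_map F (u - v) = aug_map F u - aug_map F v"
  by (simp add: aug_map_def left_diff_distrib sum_subtractf)

lemma aug_map_Var: "aug_map F (vec_Var i * v) = Var i * aug_map F v"
  by (simp add: aug_map_def sum_distrib_left mult.assoc)

section \<open>The second shifts of the resolution\<close>

locale toric_resolution =
  fixes n :: nat and a :: "nat \<Rightarrow> nat^3" and F :: "'k::field graded_complex"
  assumes three_le: "3 \<le> n"
    and res: "min_graded_free_res n a (toric_ideal n a) F"
begin

abbreviation "FM j \<equiv> free_mod (last3 n) (rk F j)"

abbreviation "hc j \<equiv> hcomp n a (shift F j)"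

abbreviation "S \<equiv> affine_monoid n a"

text \<open>A homogeneous polynomial lies in the toric ideal iff its coefficients sum to \<open>0\<close>; so on
  homogeneous vectors \<open>\<psi>\<close> detects the kernel of the augmentation.\<close>

definition \<psi> :: "(nat \<Rightarrow> 'k mpoly) \<Rightarrow> 'k" where
  "\<psi> v = csum (aug_map F v)"

abbreviation "X \<equiv> vec_Var (n - 2) :: nat \<Rightarrow> 'k mpoly"
abbreviation "Y \<equiv> vec_Var (n - 1) :: nat \<Rightarrow> 'k mpoly"
abbreviation "Z \<equiv> vec_Var n :: nat \<Rightarrow> 'k mpoly"
abbreviation "e1 \<equiv> a (n - 2)"
abbreviation "e2 \<equiv> a (n - 1)"
abbreviation "e3 \<equiv> a n"

lemma hc_X: "hc j s \<delta> (X * v) = X * hc j s (\<delta> + e1) v"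
  and hc_Y: "hc j s \<delta> (Y * v) = Y * hc j s (\<delta> + e2) v"
  and hc_Z: "hc j s \<delta> (Z * v) = Z * hc j s (\<delta> + e3) v"
  using three_le by (auto intro!: hcomp_Var)

lemmas hc_simps = hcomp_add hcomp_diff hc_X hc_Y hc_Z

lemma FM_XYZ: "v \<in> FM j \<Longrightarrow> X * v \<in> FM j" "v \<in> FM j \<Longrightarrow> Y * v \<in> FM j" "v \<in> FM j \<Longrightarrow> Z * v \<in> FM j"
  by (auto intro!: free_mod_Var)

lemma psi_add: "\<psi> (u + v) = \<psi> u + \<psi> v"
  by (simp add: \<psi>_def aug_map_add csum_add)

lemma psi_diff: "\<psi> (u - v) = \<psi> u - \<psi> v"
  by (simp add: \<psi>_def aug_map_diff csum_diff)

lemma psi_Var: "\<psi> (vec_Var i * v) = \<psi> v"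
  by (simp add: \<psi>_def aug_map_Var csum_mult)

lemma graded: "is_graded_complex n a F"
  and exact: "exact_augmented n (toric_ideal n a) F"
  using res by (auto simp: min_graded_free_res_def)

lemma dmat_polys: "p < rk F j \<Longrightarrow> q < rk F (Suc j) \<Longrightarrow> dmat F j p q \<in> polys (last3 n)"
  using graded unfolding is_graded_complex_def by blast

text \<open>The matrix entries are homogeneous, with degrees equal to differences of shifts, so
  differentials respect components.\<close>

lemma dmap_hc: "hc j s \<delta> (dmap F j v) = dmap F j (hc (Suc j) s \<delta> v)"
proof (rule ext)
  fix p
  show "hc j s \<delta> (dmap F j v) p = dmap F j (hc (Suc j) s \<delta> v) p"
  proof (cases "p < rk F j")
    case True
    have "part (\<lambda>m. sdeg n a m + shift F j p + \<delta> = s) (dmat F j p q * v q) =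
        dmat F j p q * part (\<lambda>m. sdeg n a m + shift F (Suc j) q + \<delta> = s) (v q)"
      if "q < rk F (Suc j)" for q
    proof (rule part_mult)
      fix m m' assume "m \<in> keys (dmat F j p q)"
      then have "sdeg n a m + shift F j p = shift F (Suc j) q"
        using graded True that unfolding is_graded_complex_def by blast
      then have "sdeg n a (m + m') + shift F j p = sdeg n a m' + shift F (Suc j) q"
        by (simp add: sdeg_add ac_simps flip: \<open>_ = shift F (Suc j) q\<close>)
      then show "sdeg n a (m + m') + shift F j p + \<delta> = s \<longleftrightarrow> sdeg n a m' + shift F (Suc j) q + \<delta> = s"
        by simp
    qed
    then show ?thesis
      using True by (simp add: hcomp_def dmap_def part_sum)
  qed (simp add: hcomp_def dmap_def)
qed

lemma aug_map_hc: "aug_map F (hc 0 s \<delta> v) = part (\<lambda>m. sdeg n a m + \<delta> = s) (aug_map F v)"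
proof -
  have "part (\<lambda>m. sdeg n a m + \<delta> = s) (aug F q * v q) =
      aug F q * part (\<lambda>m. sdeg n a m + shift F 0 q + \<delta> = s) (v q)" if "q < rk F 0" for q
  proof (rule part_mult)
    fix m m' assume "m \<in> keys (aug F q)"
    then have "sdeg n a m = shift F 0 q"
      using graded that unfolding is_graded_complex_def by blast
    then show "sdeg n a (m + m') + \<delta> = s \<longleftrightarrow> sdeg n a m' + shift F 0 q + \<delta> = s"
      by (simp add: sdeg_add ac_simps)
  qed
  then show ?thesis
    by (simp add: aug_map_def part_sum hcomp_def mult.commute)
qed

lemma exact_0:
  assumes "v \<in> FM 0"
  shows "aug_map F v \<in> toric_ideal n a \<longleftrightarrow> (\<exists>u\<in>FM 1. v = dmap F 0 u)"
proof -
  have "{v \<in> FM 0. aug_map F v \<in> toric_ideal n a} = dmap F 0 ` FM 1"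
    using exact unfolding exact_augmented_def by blast
  then show ?thesis
    using assms by blast
qed

lemma dmap_in_FM: "u \<in> FM (Suc j) \<Longrightarrow> dmap F j u \<in> FM j"
  by (auto simp: free_mod_def dmap_def intro!: polys_sum polys_mult dmat_polys)

lemma exact_Suc:
  assumes "v \<in> FM (Suc j)"
  shows "dmap F j v = 0 \<longleftrightarrow> (\<exists>u\<in>FM (Suc (Suc j)). v = dmap F (Suc j) u)"
proof -
  have "{v \<in> FM (Suc j). dmap F j v = (\<lambda>_. 0)} = dmap F (Suc j) ` FM (Suc (Suc j))"
    using exact unfolding exact_augmented_def by blast
  then show ?thesis
    using assms unfolding zero_fun_def by blast
qed

lemma dmap_in_FM_0: "u \<in> FM 1 \<Longrightarrow> dmap F 0 u \<in> FM 0"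
  and dmap_in_FM_1: "u \<in> FM 2 \<Longrightarrow> dmap F 1 u \<in> FM 1"
  using dmap_in_FM[of u 0] dmap_in_FM[of u 1] by (simp_all add: numeral_2_eq_2 One_nat_def)

lemma dmap_hc_0: "hc 0 s \<delta> (dmap F 0 v) = dmap F 0 (hc 1 s \<delta> v)"
  and dmap_hc_1: "hc 1 s \<delta> (dmap F 1 v) = dmap F 1 (hc 2 s \<delta> v)"
  using dmap_hc[of 0 s \<delta> v] dmap_hc[of 1 s \<delta> v] by (simp_all add: numeral_2_eq_2 One_nat_def)

lemma exact_1: "v \<in> FM 1 \<Longrightarrow> dmap F 0 v = 0 \<longleftrightarrow> (\<exists>u\<in>FM 2. v = dmap F 1 u)"
  using exact_Suc[of v 0] by (simp add: numeral_2_eq_2 One_nat_def)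

lemma exact_2: "v \<in> FM 2 \<Longrightarrow> dmap F 1 v = 0 \<longleftrightarrow> (\<exists>u\<in>FM 3. v = dmap F 2 u)"
  using exact_Suc[of v 1] by (simp add: numeral_2_eq_2 numeral_3_eq_3 One_nat_def)

lemma dmap_dmap: "u \<in> FM 2 \<Longrightarrow> dmap F 0 (dmap F 1 u) = 0"
  using exact_1 dmap_in_FM_1 by blast

text \<open>Minimality of the resolution enters here: every matrix entry lies in the ideal of the
  variables.\<close>

lemma dmap_const: "lookup (dmap F j v p) 0 = 0"
proof (cases "p < rk F j")
  case True
  have "lookup (dmat F j p q * v q) 0 = 0" if "q < rk F (Suc j)" for q
  proof (rule ccontr)
    assume "lookup (dmat F j p q * v q) 0 \<noteq> 0"
    then obtain b c where bc: "0 = b + c" "b \<in> keys (dmat F j p q)"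
      using keys_mult[of "dmat F j p q" "v q"] by (auto simp: in_keys_iff[symmetric])
    have "keys b = {}"
      using bc(1) keys_mono_add[of b c] by simp
    moreover have "dmat F j p q \<in> ideal_of (last3 n) (Var ` last3 n)"
      using res True that unfolding min_graded_free_res_def by blast
    then have "keys b \<inter> last3 n \<noteq> {}"
      using bc(2) by (subst (asm) ideal_of_Vars_iff) auto
    ultimately show False
      by blast
  qed
  then show ?thesis
    using True by (simp add: dmap_def lookup_sum)
qed (simp add: dmap_def)

text \<open>Boundaries are sent into the toric ideal by the augmentation, and for homogeneous
  vectors this means a vanishing coefficient sum.\<close>

lemma psi_dmap:
  assumes "u \<in> FM 1" "hc 1 s \<delta> u = u"
  shows "\<psi> (dmap F 0 u) = 0"
proof -
  have "dmap F 0 u = hc 0 s \<delta> (dmap F 0 u)"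
    using assms(2) by (simp add: dmap_hc_0)
  moreover have "aug_map F (dmap F 0 u) \<in> toric_ideal n a"
    using assms(1) exact_0 dmap_in_FM_0 by blast
  ultimately show ?thesis
    unfolding \<psi>_def by (metis aug_map_hc csum_part_toric_ideal)
qed

lemma aug_map_polys: "v \<in> FM 0 \<Longrightarrow> aug_map F v \<in> polys {1..n}"
  unfolding aug_map_def
proof (intro polys_sum polys_mult)
  fix q assume "v \<in> FM 0" "q \<in> {..<rk F 0}"
  then show "v q \<in> polys {1..n}"
    by (intro polys_mono[OF last3_subset[OF three_le] free_mod_polys])
qed (use graded in \<open>auto simp: is_graded_complex_def\<close>)

lemma hc_keys_aug_map:
  assumes "hc 0 s \<delta> v = v" "m \<in> keys (aug_map F v)"
  shows "sdeg n a m + \<delta> = s"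
proof -
  have "aug_map F v = part (\<lambda>m. sdeg n a m + \<delta> = s) (aug_map F v)"
    using aug_map_hc[of s \<delta> v] unfolding assms(1) .
  then have "m \<in> keys (part (\<lambda>m. sdeg n a m + \<delta> = s) (aug_map F v))"
    using assms(2) by (rule subst)
  then show ?thesis
    by (simp add: keys_part)
qed

text \<open>A homogeneous vector with \<open>\<psi> v = 0\<close> is in the kernel of the
  augmentation. Any preimage given by exactness may be replaced by its component of the right
  degree.\<close>

lemma lift_dmap_0:
  assumes v: "v \<in> FM 0" "hc 0 s \<delta> v = v" and "\<psi> v = 0"
  obtains u where "u \<in> FM 1" "hc 1 s \<delta> u = u" "dmap F 0 u = v"
proof -
  have "aug_map F v \<in> toric_ideal n a"
    using toric_ideal_homogeneous_iff[OF aug_map_polys[OF v(1)] hc_keys_aug_map[OF v(2)]] assms(3)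
    by (simp add: \<psi>_def)
  then obtain u where "u \<in> FM 1" "v = dmap F 0 u"
    using exact_0[OF v(1)] by blast
  then show ?thesis
    using that[of "hc 1 s \<delta> u"] v(2) by (simp add: free_mod_hcomp hcomp_idem flip: dmap_hc_0)
qed

lemma lift_dmap_1:
  assumes v: "v \<in> FM 1" "hc 1 s \<delta> v = v" and "dmap F 0 v = 0"
  obtains u where "u \<in> FM 2" "hc 2 s \<delta> u = u" "dmap F 1 u = v"
proof -
  obtain u where "u \<in> FM 2" "v = dmap F 1 u"
    using exact_1[OF v(1)] assms(3) by blast
  then show ?thesis
    using that[of "hc 2 s \<delta> u"] v(2) by (simp add: free_mod_hcomp hcomp_idem flip: dmap_hc_1)
qed

text \<open>Together with \<open>lift_dmap_0\<close> and \<open>psi_one_exists\<close> this encodes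
  that the quotient ring has dimension 1 in the degrees of the monoid and 0 elsewhere.\<close>

lemma psi_nonzero_degree:
  assumes "v \<in> FM 0" "hc 0 s \<delta> v = v" "\<psi> v \<noteq> 0"
  shows "\<exists>t\<in>S. t + \<delta> = s"
proof -
  obtain m where m: "m \<in> keys (aug_map F v)"
    using assms(3) unfolding \<psi>_def by (metis csum_zero keys_eq_empty ex_in_conv)
  then show ?thesis
    using hc_keys_aug_map[OF assms(2) m] polys_keysD[OF aug_map_polys[OF assms(1)] m]
    by (intro bexI[of _ "sdeg n a m"]) (auto simp: affine_monoid_iff)
qed

text \<open>The augmentation is onto modulo the toric ideal, so it reaches a monomial of degree
  \<open>t\<close>, whose coefficient sum is 1.\<close>

lemma psi_one_exists:
  assumes "t \<in> S" "t + \<delta> = s"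
  obtains v where "v \<in> FM 0" "hc 0 s \<delta> v = v" "\<psi> v = 1"
proof -
  obtain m where m: "keys m \<subseteq> {1..n}" "sdeg n a m = t"
    using assms(1) by (auto simp: affine_monoid_iff)
  have "(mon m :: 'k mpoly) \<in> polys {1..n}"
    using m(1) by (rule polys_single)
  then obtain v where v: "v \<in> FM 0" "mon m - aug_map F v \<in> toric_ideal n a"
    using exact unfolding exact_augmented_def by blast
  have "csum (part (\<lambda>m. sdeg n a m + \<delta> = s) (mon m - aug_map F v)) = 0"
    using v(2) by (rule csum_part_toric_ideal)
  moreover have "part (\<lambda>m. sdeg n a m + \<delta> = s) (mon m) = (mon m :: 'k mpoly)"
    by (rule part_id) (use m(2) assms(2) in auto)
  ultimately have "\<psi> (hc 0 s \<delta> v) = 1"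
    by (simp add: \<psi>_def aug_map_hc part_diff csum_diff)
  then show ?thesis
    using that[of "hc 0 s \<delta> v"] v(1) by (simp add: free_mod_hcomp hcomp_idem)
qed

lemma hom_maximal_ideal:
  assumes v: "v \<in> FM j" "hc j s 0 v = v" and "\<And>q. lookup (v q) 0 = 0"
  obtains f1 f2 f3 where "f1 \<in> FM j" "f2 \<in> FM j" "f3 \<in> FM j"
    "hc j s e1 f1 = f1" "hc j s e2 f2 = f2" "hc j s e3 f3 = f3" "v = X * f1 + Y * f2 + Z * f3"
proof -
  obtain f1 f2 f3 where f: "f1 \<in> FM j" "f2 \<in> FM j" "f3 \<in> FM j" "v = X * f1 + Y * f2 + Z * f3"
    using free_mod_maximal_ideal[OF v(1) assms(3)] by blast
  have "v = X * hc j s e1 f1 + Y * hc j s e2 f2 + Z * hc j s e3 f3"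
    using v(2) unfolding f(4) hc_simps add_0_left by (rule sym)
  then show ?thesis
    by (intro that[of "hc j s e1 f1" "hc j s e2 f2" "hc j s e3 f3"] free_mod_hcomp f(1-3) hcomp_idem)
qed

lemma XYZ_distinct: "n - 2 \<noteq> n - 1" "n - 2 \<noteq> n" "n - 1 \<noteq> n" "n \<in> last3 n"
  using three_le by auto

text \<open>Taking components of a Koszul preimage keeps it a preimage; each \<open>g\<close> has
  the degree left after removing two of the three generators from \<open>s\<close>.\<close>

lemma hom_koszul_exact:
  assumes f: "f1 \<in> FM j" "f2 \<in> FM j" "hc j s e1 f1 = f1" "hc j s e2 f2 = f2" "hc j s e3 f3 = f3"
    and eq: "X * f1 + Y * f2 + Z * f3 = 0"
  obtains g1 g2 g3 where "g1 \<in> FM j" "g2 \<in> FM j" "g3 \<in> FM j"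
    "hc j s (e2 + e3) g1 = g1" "hc j s (e1 + e3) g2 = g2" "hc j s (e1 + e2) g3 = g3"
    "f1 = Y * g3 - Z * g2" "f2 = Z * g1 - X * g3" "f3 = X * g2 - Y * g1"
proof -
  obtain g1 g2 g3 where g: "g1 \<in> FM j" "g2 \<in> FM j" "g3 \<in> FM j"
    and fg: "f1 = Y * g3 - Z * g2" "f2 = Z * g1 - X * g3" "f3 = X * g2 - Y * g1"
    using koszul_exact_1[OF XYZ_distinct f(1,2) eq] by blast
  let ?g1 = "hc j s (e2 + e3) g1" and ?g2 = "hc j s (e1 + e3) g2" and ?g3 = "hc j s (e1 + e2) g3"
  have "hc j s e1 (Y * g3 - Z * g2) = Y * ?g3 - Z * ?g2"
    "hc j s e2 (Z * g1 - X * g3) = Z * ?g1 - X * ?g3"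
    "hc j s e3 (X * g2 - Y * g1) = X * ?g2 - Y * ?g1"
    by (simp_all only: hc_simps add.commute)
  then have fg': "f1 = Y * ?g3 - Z * ?g2" "f2 = Z * ?g1 - X * ?g3" "f3 = X * ?g2 - Y * ?g1"
    using f(3-5) unfolding fg by argo+
  show ?thesis
    by (rule that[OF _ _ _ _ _ _ fg']) (simp_all add: g free_mod_hcomp hcomp_idem)
qed

text \<open>If \<open>s - e2 - e3\<close> were not in the monoid, then the Koszul cycle obtained by lifting a basis
  element of degree \<open>s\<close> through the resolution would be a boundary, and the basis element would lie
  in the maximal ideal times the free module.\<close>

lemma shift_2_degree:
  assumes q: "q < rk F 2"
  shows "\<exists>t\<in>S. t + (e2 + e3) = shift F 2 q"
proof (rule ccontr)
  assume no_t: "\<not> ?thesis"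
  define s where "s = shift F 2 q"
  \<comment> \<open>The basis element number \<open>q\<close>, homogeneous of degree
    \<open>s\<close>.\<close>
  define w :: "nat \<Rightarrow> 'k mpoly" where "w = (\<lambda>p. if p = q then 1 else 0)"
  have w: "w \<in> FM 2"
    using q by (auto simp: w_def free_mod_def)
  have hw: "hc 2 s 0 w = w"
    by (rule ext) (auto simp: hcomp_def w_def s_def intro!: part_id)
  define d where "d = dmap F 1 w"
  have d: "d \<in> FM 1" "hc 1 s 0 d = d" "\<And>p. lookup (d p) 0 = 0" "dmap F 0 d = 0"
    using w hw by (simp_all add: d_def dmap_in_FM_1 dmap_hc_1 dmap_const dmap_dmap)
  \<comment> \<open>By minimality the image of \<open>w\<close> has no constant terms, so it splits
    over the three variables.\<close>
  obtain f1 f2 f3 where f: "f1 \<in> FM 1" "f2 \<in> FM 1" "f3 \<in> FM 1"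
    and hf: "hc 1 s e1 f1 = f1" "hc 1 s e2 f2 = f2" "hc 1 s e3 f3 = f3"
    and df: "d = X * f1 + Y * f2 + Z * f3"
    using hom_maximal_ideal[OF d(1-3)] by blast
  have F0: "dmap F 0 f1 \<in> FM 0" "dmap F 0 f2 \<in> FM 0"
    using f by (simp_all add: dmap_in_FM_0)
  have hF0: "hc 0 s e1 (dmap F 0 f1) = dmap F 0 f1" "hc 0 s e2 (dmap F 0 f2) = dmap F 0 f2"
    "hc 0 s e3 (dmap F 0 f3) = dmap F 0 f3"
    using hf by (simp_all add: dmap_hc_0)
  have "X * dmap F 0 f1 + Y * dmap F 0 f2 + Z * dmap F 0 f3 = 0"
    using d(4) unfolding df dmap_add dmap_Var .
  then obtain g1 g2 g3 where g: "g1 \<in> FM 0" "g2 \<in> FM 0" "g3 \<in> FM 0"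
    and hg: "hc 0 s (e2 + e3) g1 = g1" "hc 0 s (e1 + e3) g2 = g2" "hc 0 s (e1 + e2) g3 = g3"
    and fg: "dmap F 0 f1 = Y * g3 - Z * g2" "dmap F 0 f2 = Z * g1 - X * g3" "dmap F 0 f3 = X * g2 - Y * g1"
    using hom_koszul_exact[OF F0 hF0] by blast
  \<comment> \<open>A nonzero value would place \<open>s - e2 - e3\<close> in the monoid.\<close>
  have "\<psi> g1 = 0"
    using psi_nonzero_degree[OF g(1) hg(1)] no_t unfolding s_def by blast
  \<comment> \<open>The three values agree, because their differences are values of
    boundaries.\<close>
  moreover have "\<psi> g1 - \<psi> g3 = 0" "\<psi> g2 - \<psi> g1 = 0"
    using psi_dmap[OF f(2) hf(2)] psi_dmap[OF f(3) hf(3)] unfolding fg psi_diff psi_Var by auto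
  ultimately have psi_g: "\<psi> g1 = 0" "\<psi> g2 = 0" "\<psi> g3 = 0"
    by auto
  obtain h1 where h1: "h1 \<in> FM 1" "dmap F 0 h1 = g1"
    using lift_dmap_0[OF g(1) hg(1) psi_g(1)] by blast
  obtain h2 where h2: "h2 \<in> FM 1" "dmap F 0 h2 = g2"
    using lift_dmap_0[OF g(2) hg(2) psi_g(2)] by blast
  obtain h3 where h3: "h3 \<in> FM 1" "dmap F 0 h3 = g3"
    using lift_dmap_0[OF g(3) hg(3) psi_g(3)] by blast
  \<comment> \<open>Each \<open>f\<close> differs from the Koszul boundary of the \<open>h\<close>
    by a cycle of the resolution, hence by a boundary.\<close>
  have "\<exists>k\<in>FM 2. f1 - (Y * h3 - Z * h2) = dmap F 1 k"
    by (subst exact_1[symmetric]) (use f h1 h2 h3 fg in \<open>simp_all add: free_mod_diff FM_XYZ dmap_diff dmap_Var\<close>)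
  then obtain k1 where k1: "k1 \<in> FM 2" "f1 - (Y * h3 - Z * h2) = dmap F 1 k1" ..
  have "\<exists>k\<in>FM 2. f2 - (Z * h1 - X * h3) = dmap F 1 k"
    by (subst exact_1[symmetric]) (use f h1 h2 h3 fg in \<open>simp_all add: free_mod_diff FM_XYZ dmap_diff dmap_Var\<close>)
  then obtain k2 where k2: "k2 \<in> FM 2" "f2 - (Z * h1 - X * h3) = dmap F 1 k2" ..
  have "\<exists>k\<in>FM 2. f3 - (X * h2 - Y * h1) = dmap F 1 k"
    by (subst exact_1[symmetric]) (use f h1 h2 h3 fg in \<open>simp_all add: free_mod_diff FM_XYZ dmap_diff dmap_Var\<close>)
  then obtain k3 where k3: "k3 \<in> FM 2" "f3 - (X * h2 - Y * h1) = dmap F 1 k3" ..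
  \<comment> \<open>Correcting \<open>w\<close> by elements of the maximal ideal times the module
    gives a cycle, hence a boundary. So \<open>r\<close> has no constant terms, yet the correction
    leaves the constant term 1 of component \<open>q\<close> untouched.\<close>
  define r where "r = w - (X * k1 + Y * k2 + Z * k3)"
  have "dmap F 1 r = d - (X * dmap F 1 k1 + Y * dmap F 1 k2 + Z * dmap F 1 k3)"
    unfolding r_def dmap_diff dmap_add dmap_Var d_def ..
  also have "\<dots> = 0"
    unfolding df k1(2)[symmetric] k2(2)[symmetric] k3(2)[symmetric] by (simp add: algebra_simps)
  finally have "dmap F 1 r = 0" .
  moreover have "r \<in> FM 2"
    using w k1 k2 k3 unfolding r_def by (simp add: free_mod_diff free_mod_add FM_XYZ)
  ultimately obtain l where "r = dmap F 2 l"
    using exact_2 by blast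
  then have "lookup (r q) 0 = 0"
    by (simp only: dmap_const)
  moreover have "lookup (Var i * f) 0 = 0" for i and f :: "'k mpoly"
    by (rule lookup_mon_times_eq_0) (metis add_eq_0_iff_both_eq_0 lookup_single_eq lookup_zero lookup_add zero_neq_one)
  ultimately show False
    by (simp add: r_def w_def lookup_minus lookup_add lookup_one)
qed

text \<open>The converse lift: the Koszul cycle formed by the monomials of degrees \<open>s - e2 - e3\<close>,
  \<open>s - e1 - e3\<close>, \<open>s - e1 - e2\<close> is not a boundary, so it yields an element of the second free module
  that is nonzero modulo the maximal ideal.\<close>

lemma degree_shift_2:
  assumes T: "\<exists>t\<in>S. t + (e2 + e3) = s" "\<exists>t\<in>S. t + (e1 + e3) = s" "\<exists>t\<in>S. t + (e1 + e2) = s"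
    and no_t: "\<not> (\<exists>t\<in>S. t + (e1 + e2 + e3) = s)"
  shows "\<exists>q<rk F 2. shift F 2 q = s"
proof (rule ccontr)
  assume no_q: "\<not> ?thesis"
  obtain t1 where "t1 \<in> S" "t1 + (e2 + e3) = s"
    using T(1) by blast
  then obtain g1 where g1: "g1 \<in> FM 0" "hc 0 s (e2 + e3) g1 = g1" "\<psi> g1 = 1"
    by (rule psi_one_exists)
  obtain t2 where "t2 \<in> S" "t2 + (e1 + e3) = s"
    using T(2) by blast
  then obtain g2 where g2: "g2 \<in> FM 0" "hc 0 s (e1 + e3) g2 = g2" "\<psi> g2 = 1"
    by (rule psi_one_exists)
  obtain t3 where "t3 \<in> S" "t3 + (e1 + e2) = s"
    using T(3) by blast
  then obtain g3 where g3: "g3 \<in> FM 0" "hc 0 s (e1 + e2) g3 = g3" "\<psi> g3 = 1"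
    by (rule psi_one_exists)
  \<comment> \<open>The two values 1 cancel, so this entry of the Koszul boundary lifts; likewise
    for the other two.\<close>
  have "Y * g3 - Z * g2 \<in> FM 0" "hc 0 s e1 (Y * g3 - Z * g2) = Y * g3 - Z * g2" "\<psi> (Y * g3 - Z * g2) = 0"
    using g1 g2 g3 by (simp_all add: free_mod_diff FM_XYZ hc_simps psi_diff psi_Var add.commute)
  then obtain f1 where f1: "f1 \<in> FM 1" "hc 1 s e1 f1 = f1" "dmap F 0 f1 = Y * g3 - Z * g2"
    by (rule lift_dmap_0)
  have "Z * g1 - X * g3 \<in> FM 0" "hc 0 s e2 (Z * g1 - X * g3) = Z * g1 - X * g3" "\<psi> (Z * g1 - X * g3) = 0"
    using g1 g2 g3 by (simp_all add: free_mod_diff FM_XYZ hc_simps psi_diff psi_Var add.commute)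
  then obtain f2 where f2: "f2 \<in> FM 1" "hc 1 s e2 f2 = f2" "dmap F 0 f2 = Z * g1 - X * g3"
    by (rule lift_dmap_0)
  have "X * g2 - Y * g1 \<in> FM 0" "hc 0 s e3 (X * g2 - Y * g1) = X * g2 - Y * g1" "\<psi> (X * g2 - Y * g1) = 0"
    using g1 g2 g3 by (simp_all add: free_mod_diff FM_XYZ hc_simps psi_diff psi_Var add.commute)
  then obtain f3 where f3: "f3 \<in> FM 1" "hc 1 s e3 f3 = f3" "dmap F 0 f3 = X * g2 - Y * g1"
    by (rule lift_dmap_0)
  define d where "d = X * f1 + Y * f2 + Z * f3"
  have d: "d \<in> FM 1" "hc 1 s 0 d = d"
    using f1 f2 f3 unfolding d_def by (simp_all add: free_mod_add FM_XYZ hc_simps)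
  have "dmap F 0 d = 0"
    unfolding d_def dmap_add dmap_Var f1(3) f2(3) f3(3) by (simp add: algebra_simps)
  then obtain w where w: "w \<in> FM 2" "hc 2 s 0 w = w" "dmap F 1 w = d"
    using lift_dmap_1[OF d] by blast
  \<comment> \<open>A constant term in component \<open>q\<close> would have degree
    \<open>shift F 2 q\<close>, which is assumed to differ from \<open>s\<close>.\<close>
  have "lookup (w q) 0 = 0" for q
  proof (cases "q < rk F 2")
    case True
    have "lookup (w q) 0 = lookup (hc 2 s 0 w q) 0"
      by (simp only: w(2))
    also have "\<dots> = 0"
      using no_q True by (auto simp: hcomp_def lookup_part)
    finally show ?thesis .
  next
    case False
    then show ?thesis
      using w(1) by (simp add: free_mod_def)
  qed
  then obtain w1 w2 w3 where w': "w1 \<in> FM 2" "w2 \<in> FM 2" "w3 \<in> FM 2" "w = X * w1 + Y * w2 + Z * w3"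
    using free_mod_maximal_ideal[OF w(1)] by blast
  have dw: "dmap F 1 w1 \<in> FM 1" "dmap F 1 w2 \<in> FM 1"
    using w'(1,2) by (simp_all add: dmap_in_FM_1)
  have "X * (f1 - dmap F 1 w1) + Y * (f2 - dmap F 1 w2) + Z * (f3 - dmap F 1 w3) = d - dmap F 1 w"
    unfolding w'(4) d_def dmap_add dmap_Var by (simp add: algebra_simps)
  also have "\<dots> = 0"
    using w(3) by simp
  finally have cycle: "X * (f1 - dmap F 1 w1) + Y * (f2 - dmap F 1 w2) + Z * (f3 - dmap F 1 w3) = 0" .
  \<comment> \<open>The \<open>f\<close> corrected by the images of the \<open>w\<close> components
    form a Koszul cycle, hence a Koszul boundary.\<close>
  obtain h2 h3 where h: "h2 \<in> FM 1" "h3 \<in> FM 1" "f1 - dmap F 1 w1 = Y * h3 - Z * h2"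
    using koszul_exact_1[OF XYZ_distinct _ _ cycle] f1(1) f2(1) dw free_mod_diff by metis
  have "dmap F 0 (dmap F 1 w1) = 0"
    using dmap_dmap w'(1) by blast
  then have "Y * g3 - Z * g2 = Y * dmap F 0 h3 - Z * dmap F 0 h2"
    using arg_cong[OF h(3), of "dmap F 0"] unfolding dmap_diff dmap_Var f1(3) by simp
  \<comment> \<open>A relation with coefficients x_{n-1} and x_n: up to a boundary, x_n divides
    \<open>g3\<close>.\<close>
  then have "Y * (g3 - dmap F 0 h3) = Z * (g2 - dmap F 0 h2)"
    by (simp add: algebra_simps)
  then have "g3 - dmap F 0 h3 = Z * vec_quot n (g3 - dmap F 0 h3)"
    by (rule koszul_exact_2[OF XYZ_distinct(3)])
  then obtain p where p: "g3 = dmap F 0 h3 + Z * p" "p = vec_quot n (g3 - dmap F 0 h3)"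
    by (metis diff_add_cancel add.commute)
  have "p \<in> FM 0"
    unfolding p(2) using g3(1) h(2) by (simp add: free_mod_vec_quot free_mod_diff dmap_in_FM_0)
  have "hc 0 s (e1 + e2) g3 = dmap F 0 (hc 1 s (e1 + e2) h3) + Z * hc 0 s (e1 + e2 + e3) p"
    by (subst p(1)) (simp add: hc_simps dmap_hc_0)
  moreover have "\<psi> (dmap F 0 (hc 1 s (e1 + e2) h3)) = 0"
    by (rule psi_dmap[where s = s and \<delta> = "e1 + e2"]) (simp_all only: h(2) free_mod_hcomp hcomp_idem)
  \<comment> \<open>The boundary has value 0 and \<open>g3\<close> has value 1, so \<open>p\<close>
    has value 1 in degree \<open>s - e1 - e2 - e3\<close>, which was excluded.\<close>
  ultimately have "\<psi> (hc 0 s (e1 + e2 + e3) p) = 1"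
    using g3(2,3) by (simp add: psi_add psi_Var)
  then have "\<exists>t\<in>S. t + (e1 + e2 + e3) = s"
    using psi_nonzero_degree[of "hc 0 s (e1 + e2 + e3) p" s "e1 + e2 + e3"] \<open>p \<in> FM 0\<close>
    by (simp add: free_mod_hcomp hcomp_idem)
  then show False
    using no_t by blast
qed

end

section \<open>Degrees of the candidates and comparison with the shifts\<close>

lemma sdeg_add_Var:
  assumes "i \<in> {1..n}"
  shows "sdeg n a (m + Poly_Mapping.single i 1) = sdeg n a m + a i"
  by (simp only: sdeg_add sdeg_Var[OF assms])

lemma single_pred: "k \<ge> 1 \<Longrightarrow> Poly_Mapping.single i (k::nat) = Poly_Mapping.single i (k - 1) + Poly_Mapping.single i 1"
  by (simp flip: single_add)

text \<open>Lowering both exponents of the corner by one gives a standard monomial \<open>c\<close>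
  free of x_n. Its irreducibility excludes the last degree by
  \<open>irreducible_not_shifted\<close>, while reducibility of its product with x_{n-1} supplies
  the degree involving \<open>a n\<close> by \<open>reducible_last_factor\<close>.\<close>

lemma B2'_degree:
  fixes n :: nat and a :: "nat \<Rightarrow> nat^3"
  defines "L \<equiv> init_ideal n a (toric_ideal n a) :: 'k::field mpoly set"
  assumes n: "3 \<le> n" and m: "m \<in> B2' n L"
  obtains c where "keys c \<subseteq> {1..n}" "\<not> reducible n a c"
    "m = c + Poly_Mapping.single (n - 2) 1 + Poly_Mapping.single (n - 1) 1"
    "sdeg n a c + (a (n - 2) + a (n - 1)) = sdeg n a m"
    "\<exists>t\<in>affine_monoid n a. t + (a (n - 2) + a n) = sdeg n a m"
    "\<not> (\<exists>t\<in>affine_monoid n a. t + (a (n - 2) + a (n - 1) + a n) = sdeg n a m)"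
proof -
  obtain u \<alpha> \<beta> where m_eq: "m = u + Poly_Mapping.single (n - 2) \<alpha> + Poly_Mapping.single (n - 1) \<beta>"
    and u: "u \<in> B0J n L" and pos: "\<alpha> \<ge> 1" "\<beta> \<ge> 1"
    and irr: "\<not> reducible n a (u + Poly_Mapping.single (n - 2) (\<alpha> - 1) + Poly_Mapping.single (n - 1) (\<beta> - 1))"
    and red: "reducible n a (u + Poly_Mapping.single (n - 2) (\<alpha> - 1) + Poly_Mapping.single (n - 1) \<beta>)"
    using B2'_corner[OF n m[unfolded L_def]] unfolding L_def by blast
  define c where "c = u + Poly_Mapping.single (n - 2) (\<alpha> - 1) + Poly_Mapping.single (n - 1) (\<beta> - 1)"
  note keys_u = B0J_keys[OF n u[unfolded L_def]]
  have keys_c: "keys c \<subseteq> {1..n}"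
    unfolding c_def using keys_u(1) n by (auto simp: keys_mono_add)
  have "lookup c n = 0"
    unfolding c_def using keys_u(2) n by (auto simp: lookup_add lookup_single in_keys_iff)
  have red': "reducible n a (c + Poly_Mapping.single (n - 1) 1)"
    using red unfolding c_def single_pred[OF pos(2)] by (simp only: add.assoc)
  have m_c: "m = c + Poly_Mapping.single (n - 2) 1 + Poly_Mapping.single (n - 1) 1"
    unfolding m_eq c_def single_pred[OF pos(1)] single_pred[OF pos(2)] by (simp only: ac_simps)
  have "n - 2 \<in> {1..n}" "n - 1 \<in> {1..n}"
    using n by auto
  then have deg: "sdeg n a m = sdeg n a c + (a (n - 2) + a (n - 1))"
    unfolding m_c by (simp only: sdeg_add sdeg_Var add.assoc)
  obtain t where t: "t \<in> affine_monoid n a" "t + a n = sdeg n a c + a (n - 1)"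
    using reducible_last_factor[OF _ keys_c \<open>lookup c n = 0\<close> irr[folded c_def] red'] n by auto
  have "t + (a (n - 2) + a n) = sdeg n a m"
    using arg_cong[OF t(2), of "\<lambda>d. a (n - 2) + d"] unfolding deg by (simp only: ac_simps)
  moreover have "t' + (a (n - 2) + a (n - 1) + a n) \<noteq> sdeg n a m" if "t' \<in> affine_monoid n a" for t'
  proof
    assume "t' + (a (n - 2) + a (n - 1) + a n) = sdeg n a m"
    then have "(a (n - 2) + a (n - 1)) + (t' + a n) = (a (n - 2) + a (n - 1)) + sdeg n a c"
      unfolding deg by (simp only: ac_simps)
    then have "t' + a n = sdeg n a c"
      by (simp only: add_left_cancel)
    then show False
      using irreducible_not_shifted[OF _ \<open>lookup c n = 0\<close> irr[folded c_def] that] n by simp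
  qed
  ultimately show ?thesis
    using that[OF keys_c irr[folded c_def] m_c deg[symmetric]] t(1) by blast
qed

text \<open>The degree of \<open>m\<close> determines that of \<open>c\<close>, a fibre contains at
  most one standard monomial, and \<open>c\<close> determines \<open>m\<close>. This lets elements
  of \<open>B2'\<close> be recognised by their degrees.\<close>

lemma sdeg_inj_on_B2':
  assumes "3 \<le> n"
  shows "inj_on (sdeg n a) (B2' n (init_ideal n a (toric_ideal n a) :: 'k::field mpoly set))"
proof (rule inj_onI)
  fix m m'
  assume m: "m \<in> B2' n (init_ideal n a (toric_ideal n a) :: 'k mpoly set)"
    and m': "m' \<in> B2' n (init_ideal n a (toric_ideal n a) :: 'k mpoly set)"
    and eq: "sdeg n a m = sdeg n a m'"
  obtain c where c: "keys c \<subseteq> {1..n}" "\<not> reducible n a c"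
    "m = c + Poly_Mapping.single (n - 2) 1 + Poly_Mapping.single (n - 1) 1"
    "sdeg n a c + (a (n - 2) + a (n - 1)) = sdeg n a m"
    using B2'_degree[OF assms m] by metis
  obtain c' where c': "keys c' \<subseteq> {1..n}" "\<not> reducible n a c'"
    "m' = c' + Poly_Mapping.single (n - 2) 1 + Poly_Mapping.single (n - 1) 1"
    "sdeg n a c' + (a (n - 2) + a (n - 1)) = sdeg n a m'"
    using B2'_degree[OF assms m'] by metis
  have "sdeg n a c = sdeg n a c'"
    using c(4) c'(4) eq by (metis add_right_cancel)
  then show "m = m'"
    using irreducible_unique[OF c(2) c'(2) _ c(1) c'(1)] c(3) c'(3) by simp
qed

text \<open>By \<open>B2'_degree\<close>, with \<open>s\<close> the degree of an element of
  \<open>B2'\<close>, the only condition for a shift still open is that \<open>s - e2 - e3\<close>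
  lies in the monoid; it is necessary by \<open>shift_2_degree\<close> and sufficient by
  \<open>degree_shift_2\<close>.\<close>

lemma (in toric_resolution) is_B2_iff:
  assumes "is_B2 n a (toric_ideal n a) F B"
  shows "m \<in> B \<longleftrightarrow> m \<in> B2' n (init_ideal n a (toric_ideal n a) :: 'k mpoly set) \<and>
    (\<exists>t\<in>S. t + (e2 + e3) = sdeg n a m)"
proof -
  let ?B' = "B2' n (init_ideal n a (toric_ideal n a) :: 'k mpoly set)"
  have B: "B \<subseteq> ?B'" "finite B" "image_mset (sdeg n a) (mset_set B) = shifts F 2"
    using assms unfolding is_B2_def by auto
  have degrees: "sdeg n a ` B = shift F 2 ` {..<rk F 2}"
    using arg_cong[OF B(3), of set_mset] B(2) by (simp add: shifts_def)
  show ?thesis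
  proof
    assume "m \<in> B"
    then obtain q where "q < rk F 2" "sdeg n a m = shift F 2 q"
      using degrees by (metis imageE imageI lessThan_iff)
    then show "m \<in> ?B' \<and> (\<exists>t\<in>S. t + (e2 + e3) = sdeg n a m)"
      using shift_2_degree B(1) \<open>m \<in> B\<close> by (metis subsetD)
  next
    assume m: "m \<in> ?B' \<and> (\<exists>t\<in>S. t + (e2 + e3) = sdeg n a m)"
    obtain c where c: "keys c \<subseteq> {1..n}" "sdeg n a c + (e1 + e2) = sdeg n a m"
      "\<exists>t\<in>S. t + (e1 + e3) = sdeg n a m" "\<not> (\<exists>t\<in>S. t + (e1 + e2 + e3) = sdeg n a m)"
      using B2'_degree[OF three_le conjunct1[OF m]] by metis
    have "sdeg n a c \<in> S"
      using c(1) by (auto simp: affine_monoid_iff)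
    then have "\<exists>t\<in>S. t + (e1 + e2) = sdeg n a m"
      using c(2) by blast
    then obtain q where "q < rk F 2" "shift F 2 q = sdeg n a m"
      using degree_shift_2[OF conjunct2[OF m] c(3) _ c(4)] by blast
    \<comment> \<open>The shift only provides some element of \<open>B\<close> of the same degree;
      injectivity identifies it with \<open>m\<close>.\<close>
    then obtain m' where "m' \<in> B" "sdeg n a m' = sdeg n a m"
      using degrees by (metis imageE imageI lessThan_iff)
    then show "m \<in> B"
      using inj_onD[OF sdeg_inj_on_B2'[OF three_le]] B(1) m by (metis subsetD)
  qed
qed

theorem theorem3p9:
  fixes n :: nat and a :: "nat \<Rightarrow> nat^3"
    and I L :: "'k::field mpoly set"
    and F :: "'k graded_complex" and B2 :: "mono set"
  assumes "simplicial n a"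
    and "I = toric_ideal n a"
    and "L = init_ideal n a I"
    and "min_graded_free_res n a I F"
    and "is_B2 n a I F B2"
  shows "(\<forall>u \<alpha> \<beta>. u \<in> B0J n L \<and> \<alpha> \<ge> 1 \<and> \<beta> \<ge> 1 \<and>
            u + Poly_Mapping.single (n - 2) \<alpha> + Poly_Mapping.single (n - 1) \<beta> \<in> B2' n L \<longrightarrow>
            (u + Poly_Mapping.single (n - 2) \<alpha> + Poly_Mapping.single (n - 1) \<beta> \<in> B2 \<longleftrightarrow>
             mon (u + Poly_Mapping.single (n - 2) \<alpha> + Poly_Mapping.single (n - 1) (\<beta> - 1))
               \<in> ideal_sum I (ideal_of {1..n} {Var n})))
       \<and> B2 = {u + Poly_Mapping.single (n - 2) \<alpha> + Poly_Mapping.single (n - 1) \<beta> | u \<alpha> \<beta>.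
            u \<in> B0J n L \<and> \<alpha> \<ge> 1 \<and> \<beta> \<ge> 1 \<and>
            u + Poly_Mapping.single (n - 2) \<alpha> + Poly_Mapping.single (n - 1) \<beta> \<in> B2' n L \<and>
            mon (u + Poly_Mapping.single (n - 2) \<alpha> + Poly_Mapping.single (n - 1) (\<beta> - 1))
               \<in> ideal_sum I (ideal_of {1..n} {Var n})}"
proof -
  have n: "3 \<le> n"
    using assms(1) by (simp add: simplicial_def)
  interpret toric_resolution n a F
    by unfold_locales (fact n, fact assms(4)[unfolded assms(2)])
  let ?m = "\<lambda>u \<alpha> \<beta>. u + Poly_Mapping.single (n - 2) \<alpha> + Poly_Mapping.single (n - 1) (\<beta>::nat)"
  have L: "L = init_ideal n a (toric_ideal n a)"
    using assms(2,3) by simp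
  have B2: "m \<in> B2 \<longleftrightarrow> m \<in> B2' n L \<and> (\<exists>t\<in>S. t + (e2 + e3) = sdeg n a m)" for m
    using is_B2_iff[of B2 m] assms(2,5) unfolding L by simp
  \<comment> \<open>Removing one factor x_{n-1} removes \<open>e2\<close> from the degree, so the
    ideal condition says that a further \<open>e3\<close> can be removed within the monoid.\<close>
  have cond: "mon (?m u \<alpha> (\<beta> - 1)) \<in> ideal_sum I (ideal_of {1..n} {Var n}) \<longleftrightarrow>
      (\<exists>t\<in>S. t + (e2 + e3) = sdeg n a (?m u \<alpha> \<beta>))" if "u \<in> B0J n L" "\<beta> \<ge> 1" for u \<alpha> \<beta>
  proof -
    have "?m u \<alpha> \<beta> = ?m u \<alpha> (\<beta> - 1) + Poly_Mapping.single (n - 1) 1"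
      unfolding single_pred[OF that(2)] by (simp only: add.assoc)
    moreover have "n - 1 \<in> {1..n}"
      using n by auto
    ultimately have deg: "sdeg n a (?m u \<alpha> \<beta>) = sdeg n a (?m u \<alpha> (\<beta> - 1)) + e2"
      by (simp only: sdeg_add_Var)
    have "t + (e2 + e3) = t + e3 + e2" for t
      by (simp only: ac_simps)
    then have "t + (e2 + e3) = sdeg n a (?m u \<alpha> \<beta>) \<longleftrightarrow> t + e3 = sdeg n a (?m u \<alpha> (\<beta> - 1))" for t
      by (simp only: deg add_right_cancel)
    moreover have "keys (?m u \<alpha> (\<beta> - 1)) \<subseteq> {1..n}"
      using B0J_keys(1)[OF n that(1)[unfolded L]] n by (auto simp: keys_mono_add)
    ultimately show ?thesis
      unfolding assms(2) using n by (subst mon_in_toric_plus_Var_iff) auto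
  qed
  \<comment> \<open>Every candidate has a representation with positive exponents, so the equality of
    sets follows from the equivalence.\<close>
  have shape: "\<exists>u \<alpha> \<beta>. m = ?m u \<alpha> \<beta> \<and> u \<in> B0J n L \<and> \<alpha> \<ge> 1 \<and> \<beta> \<ge> 1" if "m \<in> B2' n L" for m
    using B2'_corner[OF n that[unfolded L]] unfolding L by metis
  show ?thesis
  proof (intro conjI allI impI set_eqI iffI)
    fix m assume "m \<in> B2"
    then show "m \<in> {?m u \<alpha> \<beta> | u \<alpha> \<beta>. u \<in> B0J n L \<and> \<alpha> \<ge> 1 \<and> \<beta> \<ge> 1 \<and> ?m u \<alpha> \<beta> \<in> B2' n L \<and>
        mon (?m u \<alpha> (\<beta> - 1)) \<in> ideal_sum I (ideal_of {1..n} {Var n})}"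
      using shape[of m] B2[of m] cond by blast
  qed (use B2 cond in blast)+
qed

end
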